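(* Let $\mathbb{K}$ be an algebraically closed field of characteristic different from $2$ and $3$. Any polynomial identity of the algebra $\left(\mathbb{K}^{6\times 6}\right)^2$ is a polynomial identity of $\mathcal{T}(\alpha_1,\alpha_2,\alpha_3)$ for any $\alpha_1,\alpha_2,\alpha_3\in\mathbb{K}$.
   Context: $\mathcal{T}(\alpha_1,\alpha_2,\alpha_3)$ denotes the associative unital $\mathbb{K}$-algebra given by generators $a,b,c,d$ and relations $$a^2=b^2=c^2=d^2=\alpha_1,$$ $$ca+bc+ab=\alpha_2,\quad da+cd+ac=\alpha_2,\quad db+ba+ad=\alpha_2,\quad dc+cb+bd=\alpha_2,$$ $$(cb+ba+ac-\alpha_2)^3=\alpha_3.$$ A polynomial identity of a $\mathbb{K}$-algebra $A$ is an element $f(X_1,\dots,X_m)$ of a free associative $\mathbb{K}$-algebra $\mathbb{K}\langle X_1,\dots,X_m\rangle$ such that $f(x_1,\dots,x_m)=0$ for all $x_1,\dots,x_m\in A$. $\left(\mathbb{K}^{6\times 6}\right)^2$ is the direct product of two copies of the algebra of $6\times 6$ matrices over $\mathbb{K}$. *)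

theory Defs
  imports
    "HOL-Library.Poly_Mapping"
    "HOL-Computational_Algebra.Polynomial"
    "HOL-Algebra.QuotRing"
    "HOL-Algebra.Chinese_Remainder"
    "HOL-Algebra.Module"
    "Jordan_Normal_Form.Matrix"
begin

text \<open>
  Algebras over a field \<open>'k\<close> are represented by the record type \<open>('k, 'a) module\<close>:
  the ring operations together with scalar multiplication.
\<close>

text \<open>
  The free monoid on \<open>'x\<close>, written additively so that multiplication of finitely supported
  functions (class \<^class>\<open>monoid_add\<close> on the exponents) is the product of the monoid algebra.
  Thus \<open>'x word \<Rightarrow>\<^sub>0 'k\<close> is the free associative unital \<open>'k\<close>-algebra on \<open>'x\<close>.
\<close>

datatype 'x word = Word (letters: "'x list")

instantiation word :: (type) monoid_add
begin

definition "0 = Word []"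

definition "v + w = Word (letters v @ letters w)"

instance
  by standard (simp_all add: zero_word_def plus_word_def)

end

definition gen :: "'x \<Rightarrow> ('x word \<Rightarrow>\<^sub>0 'k::field)" where
  "gen i = Poly_Mapping.single (Word [i]) 1"

definition scal :: "'k::field \<Rightarrow> ('x word \<Rightarrow>\<^sub>0 'k)" where
  "scal c = Poly_Mapping.single 0 c"

definition free_algebra :: "('k::field, 'x word \<Rightarrow>\<^sub>0 'k) module" where
  "free_algebra = \<lparr>carrier = UNIV, mult = (*), one = 1, zero = 0, add = (+),
     smult = (\<lambda>c f. scal c * f)\<rparr>"

text \<open>The free algebra on \<open>X\<^sub>1, \<dots>, X\<^sub>m\<close>, inside the one on countably many letters.\<close>

definition ncpolys :: "nat \<Rightarrow> (nat word \<Rightarrow>\<^sub>0 'k::field) set" where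
  "ncpolys m = {f. \<forall>w\<in>Poly_Mapping.keys f. set (letters w) \<subseteq> {1..m}}"

definition word_eval :: "('k, 'a, 'b) module_scheme \<Rightarrow> ('x \<Rightarrow> 'a) \<Rightarrow> 'x word \<Rightarrow> 'a" where
  "word_eval A x w = foldr (\<lambda>i r. x i \<otimes>\<^bsub>A\<^esub> r) (letters w) \<one>\<^bsub>A\<^esub>"

definition ncpoly_eval ::
    "('k::field, 'a, 'b) module_scheme \<Rightarrow> ('x \<Rightarrow> 'a) \<Rightarrow> ('x word \<Rightarrow>\<^sub>0 'k) \<Rightarrow> 'a" where
  "ncpoly_eval A x f =
     (\<Oplus>\<^bsub>A\<^esub>w\<in>Poly_Mapping.keys f. Poly_Mapping.lookup f w \<odot>\<^bsub>A\<^esub> word_eval A x w)"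

definition polynomial_identity ::
    "('k::field, 'a, 'b) module_scheme \<Rightarrow> nat \<Rightarrow> (nat word \<Rightarrow>\<^sub>0 'k) \<Rightarrow> bool" where
  "polynomial_identity A m f \<longleftrightarrow>
     f \<in> ncpolys m \<and> (\<forall>x. (\<forall>i\<in>{1..m}. x i \<in> carrier A) \<longrightarrow> ncpoly_eval A x f = \<zero>\<^bsub>A\<^esub>)"

definition algebra_prod ::
    "('k, 'a, 'c) module_scheme \<Rightarrow> ('k, 'b, 'd) module_scheme \<Rightarrow> ('k, 'a \<times> 'b) module" where
  "algebra_prod A B = ring.extend (RDirProd A B)
     \<lparr>smult = (\<lambda>c (x, y). (c \<odot>\<^bsub>A\<^esub> x, c \<odot>\<^bsub>B\<^esub> y))\<rparr>"

definition quotient_algebra ::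
    "('k, 'a, 'b) module_scheme \<Rightarrow> 'a set \<Rightarrow> ('k, 'a set) module" where
  "quotient_algebra A I = ring.extend (A Quot I)
     \<lparr>smult = (\<lambda>c X. \<Union>x\<in>X. I +>\<^bsub>A\<^esub> (c \<odot>\<^bsub>A\<^esub> x))\<rparr>"

datatype generator = GenA | GenB | GenC | GenD

definition T_relators :: "'k::field \<Rightarrow> 'k \<Rightarrow> 'k \<Rightarrow> (generator word \<Rightarrow>\<^sub>0 'k) set" where
  "T_relators \<alpha>1 \<alpha>2 \<alpha>3 =
    (let a = gen GenA; b = gen GenB; c = gen GenC; d = gen GenD in
     {a^2 - scal \<alpha>1, b^2 - scal \<alpha>1, c^2 - scal \<alpha>1, d^2 - scal \<alpha>1,
      c * a + b * c + a * b - scal \<alpha>2,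
      d * a + c * d + a * c - scal \<alpha>2,
      d * b + b * a + a * d - scal \<alpha>2,
      d * c + c * b + b * d - scal \<alpha>2,
      (c * b + b * a + a * c - scal \<alpha>2)^3 - scal \<alpha>3})"

text \<open>\<^const>\<open>genideal\<close> generates two-sided ideals.\<close>

definition T_algebra ::
    "'k::field \<Rightarrow> 'k \<Rightarrow> 'k \<Rightarrow> ('k, (generator word \<Rightarrow>\<^sub>0 'k) set) module" where
  "T_algebra \<alpha>1 \<alpha>2 \<alpha>3 =
     quotient_algebra free_algebra (genideal free_algebra (T_relators \<alpha>1 \<alpha>2 \<alpha>3))"

end

theory Submission
  imports Defs
begin

text \<open>Put \<open>x = cb + ba + ac - \<alpha>\<^sub>2\<close>. The relations give \<open>xa = cx\<close>, \<open>xb = ax\<close>, \<open>xc = bx\<close> and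
  \<open>bab = aba + \<alpha>\<^sub>2 (b - a)\<close>, so the algebra is spanned by the \<open>72\<close> words \<open>u c\<^sup>e x\<^sup>j d\<^sup>f\<close> with
  \<open>u \<in> {1, a, b, ab, ba, aba}\<close>, \<open>e, f < 2\<close>, \<open>j < 3\<close>, with coefficients that are polynomial in the
  parameters. For generic parameters there are two \<open>6\<close>-dimensional representations that agree on
  \<open>a, b, c\<close> and differ on \<open>d\<close>. The images of \<open>a, b, c\<close> generate all \<open>6 \<times> 6\<close> matrices, so the
  \<open>36\<close> words without \<open>d\<close> are independent, and as the difference of the two images of \<open>d\<close> is
  invertible, the \<open>72\<close> words are independent in the product of the two matrix algebras.

  Now deform \<open>(\<alpha>\<^sub>1, \<alpha>\<^sub>2, \<alpha>\<^sub>3)\<close> to \<open>(\<alpha>\<^sub>1 + t, \<alpha>\<^sub>2, \<alpha>\<^sub>3 + t)\<close>. A value of an identity of the matrix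
  algebra is a combination of the words whose coefficients are polynomials in \<open>t\<close> that vanish for
  generic \<open>t\<close>. Hence they are zero, also at \<open>t = 0\<close>.\<close>

section \<open>Evaluation of noncommutative polynomials\<close>

text \<open>A finitely supported function is the sum of its monomials, so a property stable under
  addition has to be checked on monomials only. The zero function is covered as a monomial with
  coefficient \<open>0\<close>.\<close>

lemma poly_mapping_monomial_induct [case_names single add]:
  fixes f :: "'a \<Rightarrow>\<^sub>0 'b::comm_monoid_add"
  assumes single: "\<And>w c. P (Poly_Mapping.single w c)"
    and add: "\<And>f g. P f \<Longrightarrow> P g \<Longrightarrow> P (f + g)"
  shows "P f"
proof -
  have "P (\<Sum>w\<in>A. Poly_Mapping.single w (Poly_Mapping.lookup f w))" if "finite A" for A
    using that
  proof (induction A)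
    case empty
    show ?case using single[of undefined 0] by simp
  qed (auto intro: single add)
  moreover have "(\<Sum>w\<in>Poly_Mapping.keys f. Poly_Mapping.single w (Poly_Mapping.lookup f w)) = f"
    by (rule poly_mapping_eqI)
      (simp add: lookup_sum lookup_single when_def in_keys_iff)
  ultimately show ?thesis by (metis finite_keys)
qed

definition word_prod :: "('x \<Rightarrow> 'r::monoid_mult) \<Rightarrow> 'x word \<Rightarrow> 'r" where
  "word_prod \<phi> w = prod_list (map \<phi> (letters w))"

lemma word_prod_zero [simp]: "word_prod \<phi> 0 = 1"
  and word_prod_add: "word_prod \<phi> (v + w) = word_prod \<phi> v * word_prod \<phi> w"
  and word_prod_gen [simp]: "word_prod \<phi> (Word [i]) = \<phi> i"
  by (simp_all add: word_prod_def zero_word_def plus_word_def)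

text \<open>Evaluation in a type-class ring, where algebraic simplification is available;
  \<open>\<iota>\<close> is the structure map of the algebra, below \<open>scal\<close> or
  \<open>scalar6\<close>.\<close>

definition free_eval :: "('k::field \<Rightarrow> 'r::ring_1) \<Rightarrow> ('x \<Rightarrow> 'r) \<Rightarrow> ('x word \<Rightarrow>\<^sub>0 'k) \<Rightarrow> 'r" where
  "free_eval \<iota> \<phi> f = (\<Sum>w\<in>Poly_Mapping.keys f. \<iota> (Poly_Mapping.lookup f w) * word_prod \<phi> w)"

locale central_embedding =
  fixes \<iota> :: "'k::field \<Rightarrow> 'r::ring_1"
  assumes \<iota>_add: "\<iota> (x + y) = \<iota> x + \<iota> y"
    and \<iota>_mult: "\<iota> (x * y) = \<iota> x * \<iota> y"
    and \<iota>_1 [simp]: "\<iota> 1 = 1"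
    and \<iota>_central: "\<iota> x * u = u * \<iota> x"
begin

lemma \<iota>_0 [simp]: "\<iota> 0 = 0"
  using \<iota>_add[of 0 0] by simp

lemma \<iota>_minus: "\<iota> (- x) = - \<iota> x"
  using \<iota>_add[of x "- x"] by (simp add: eq_neg_iff_add_eq_0 add.commute)

lemma free_eval_superset:
  assumes "finite A" "Poly_Mapping.keys f \<subseteq> A"
  shows "free_eval \<iota> \<phi> f = (\<Sum>w\<in>A. \<iota> (Poly_Mapping.lookup f w) * word_prod \<phi> w)"
  unfolding free_eval_def using assms
  by (intro sum.mono_neutral_left) (auto simp: in_keys_iff)

lemma free_eval_single: "free_eval \<iota> \<phi> (Poly_Mapping.single w c) = \<iota> c * word_prod \<phi> w"
  by (subst free_eval_superset[of "{w}"]) auto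

lemma free_eval_add: "free_eval \<iota> \<phi> (f + g) = free_eval \<iota> \<phi> f + free_eval \<iota> \<phi> g"
proof -
  let ?A = "Poly_Mapping.keys f \<union> Poly_Mapping.keys g"
  have "Poly_Mapping.keys (f + g) \<subseteq> ?A" by (rule Poly_Mapping.keys_add)
  then show ?thesis
    by (simp add: free_eval_superset[of ?A] lookup_add \<iota>_add distrib_right sum.distrib)
qed

lemma free_eval_0 [simp]: "free_eval \<iota> \<phi> 0 = 0"
  by (simp add: free_eval_def)

lemma free_eval_minus: "free_eval \<iota> \<phi> (- f) = - free_eval \<iota> \<phi> f"
  using free_eval_add[of \<phi> f "- f"] by (simp add: eq_neg_iff_add_eq_0 add.commute)

lemma free_eval_diff: "free_eval \<iota> \<phi> (f - g) = free_eval \<iota> \<phi> f - free_eval \<iota> \<phi> g"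
  using free_eval_add[of \<phi> f "- g"] by (simp add: free_eval_minus)

lemma free_eval_sum: "free_eval \<iota> \<phi> (sum f A) = (\<Sum>a\<in>A. free_eval \<iota> \<phi> (f a))"
  by (induction A rule: infinite_finite_induct) (simp_all add: free_eval_add)

lemma free_eval_mult: "free_eval \<iota> \<phi> (f * g) = free_eval \<iota> \<phi> f * free_eval \<iota> \<phi> g"
proof (induction f rule: poly_mapping_monomial_induct)
  case (single v c)
  show ?case
  proof (induction g rule: poly_mapping_monomial_induct)
    case (single w d)
    have "\<iota> (c * d) * word_prod \<phi> (v + w) = (\<iota> c * word_prod \<phi> v) * (\<iota> d * word_prod \<phi> w)"
      by (metis \<iota>_central \<iota>_mult mult.assoc word_prod_add)
    then show ?case by (simp add: mult_single free_eval_single)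
  qed (simp add: free_eval_add distrib_left)
qed (simp add: free_eval_add distrib_right)

lemma free_eval_scal [simp]: "free_eval \<iota> \<phi> (scal c) = \<iota> c"
  by (simp add: scal_def free_eval_single)

lemma free_eval_gen [simp]: "free_eval \<iota> \<phi> (gen i) = \<phi> i"
  by (simp add: gen_def free_eval_single)

lemma free_eval_1 [simp]: "free_eval \<iota> \<phi> 1 = 1"
  using free_eval_scal[of \<phi> 1] by (simp add: scal_def)

lemma free_eval_power: "free_eval \<iota> \<phi> (f ^ n) = free_eval \<iota> \<phi> f ^ n"
  by (induction n) (simp_all add: free_eval_mult)

lemma free_eval_word_prod:
  "free_eval \<iota> \<phi> (word_prod X w) = word_prod (\<lambda>i. free_eval \<iota> \<phi> (X i)) w"
proof -
  have "free_eval \<iota> \<phi> (prod_list (map X is)) = prod_list (map (\<lambda>i. free_eval \<iota> \<phi> (X i)) is)" for "is"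
    by (induction "is") (simp_all add: free_eval_mult)
  then show ?thesis by (simp add: word_prod_def)
qed

text \<open>Evaluation at \<open>\<phi>\<close> is a homomorphism, so it may be applied to the
  substituted elements first. Thus the matrix image of a value of \<open>f\<close> in the free
  algebra is again a value of \<open>f\<close>.\<close>

lemma free_eval_free_eval:
  "free_eval \<iota> \<phi> (free_eval scal X f) = free_eval \<iota> (\<lambda>i. free_eval \<iota> \<phi> (X i)) f"
  by (subst (2 3) free_eval_def) (simp add: free_eval_sum free_eval_mult free_eval_word_prod)

end

lemma scal_central: "scal c * f = f * scal c"
proof (induction f rule: poly_mapping_monomial_induct)
  case (single w d)
  show ?case by (simp add: scal_def mult_single mult.commute)
qed (simp add: distrib_left distrib_right)

interpretation scal: central_embedding "scal :: 'k::field \<Rightarrow> 'x word \<Rightarrow>\<^sub>0 'k"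
  by standard (simp_all add: scal_def single_add mult_single, metis scal_central scal_def)

text \<open>The bridge from type-class rings to algebra records: a homomorphism \<open>h\<close>
  carries values to values. It serves for the projection onto the quotient algebra and for the
  diagonal map into the product of two matrix algebras.\<close>

lemma ncpoly_eval_image:
  fixes A :: "('k::field, 'a, 'b) module_scheme" and h :: "'r::ring_1 \<Rightarrow> 'a"
  assumes "abelian_monoid A"
    and closed: "\<And>u. h u \<in> carrier A"
    and add: "\<And>u v. h (u + v) = h u \<oplus>\<^bsub>A\<^esub> h v"
    and zero: "h 0 = \<zero>\<^bsub>A\<^esub>"
    and mult: "\<And>u v. h (u * v) = h u \<otimes>\<^bsub>A\<^esub> h v"
    and one: "h 1 = \<one>\<^bsub>A\<^esub>"
    and smult: "\<And>c u. h (\<iota> c * u) = c \<odot>\<^bsub>A\<^esub> h u"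
    and x: "\<And>w i. w \<in> Poly_Mapping.keys f \<Longrightarrow> i \<in> set (letters w) \<Longrightarrow> x i = h (X i)"
  shows "ncpoly_eval A x f = h (free_eval \<iota> X f)"
proof -
  interpret abelian_monoid A by fact
  have "foldr (\<lambda>i r. x i \<otimes>\<^bsub>A\<^esub> r) is \<one>\<^bsub>A\<^esub> = h (prod_list (map X is))"
    if "\<And>i. i \<in> set is \<Longrightarrow> x i = h (X i)" for "is"
    using that by (induction "is") (simp_all add: one mult)
  then have "word_eval A x w = h (word_prod X w)" if "w \<in> Poly_Mapping.keys f" for w
    using x[OF that] by (simp add: word_eval_def word_prod_def)
  then have "ncpoly_eval A x f =
      (\<Oplus>\<^bsub>A\<^esub>w\<in>Poly_Mapping.keys f. h (\<iota> (Poly_Mapping.lookup f w) * word_prod X w))"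
    unfolding ncpoly_eval_def by (intro finsum_cong') (simp_all add: smult[symmetric] closed)
  also have "(\<Oplus>\<^bsub>A\<^esub>w\<in>W. h (g w)) = h (\<Sum>w\<in>W. g w)" if "finite W" for W and g :: "'c word \<Rightarrow> 'r"
    using that by (induction W) (simp_all add: zero add closed)
  from this[OF finite_keys] have "(\<Oplus>\<^bsub>A\<^esub>w\<in>Poly_Mapping.keys f.
      h (\<iota> (Poly_Mapping.lookup f w) * word_prod X w)) = h (free_eval \<iota> X f)"
    unfolding free_eval_def .
  finally show ?thesis .
qed

section \<open>The free algebra, the ideal of the relators and the quotient\<close>

lemma free_algebra_simps [simp]:
  "carrier free_algebra = UNIV" "mult free_algebra = (*)" "one free_algebra = 1"
  "zero free_algebra = 0" "add free_algebra = (+)" "smult free_algebra c f = scal c * f"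
  by (simp_all add: free_algebra_def)

lemma ring_free_algebra: "ring (free_algebra :: ('k::field, 'x word \<Rightarrow>\<^sub>0 'k) module)"
proof -
  have "\<exists>g. g + f = 0 \<and> f + g = 0" for f :: "'x word \<Rightarrow>\<^sub>0 'k"
    by (rule exI[of _ "- f"]) simp
  then show ?thesis
    by unfold_locales (auto simp: algebra_simps Units_def)
qed

definition T_ideal :: "'k::field \<Rightarrow> 'k \<Rightarrow> 'k \<Rightarrow> (generator word \<Rightarrow>\<^sub>0 'k) set" where
  "T_ideal p q r = genideal free_algebra (T_relators p q r)"

lemma ideal_T_ideal: "ideal (T_ideal p q r) free_algebra"
  unfolding T_ideal_def by (rule ring.genideal_ideal[OF ring_free_algebra]) simp

lemma T_relators_in_T_ideal: "T_relators p q r \<subseteq> T_ideal p q r"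
  unfolding T_ideal_def by (rule ring.genideal_self[OF ring_free_algebra]) simp

lemma T_ideal_0: "0 \<in> T_ideal p q r"
  and T_ideal_add: "f \<in> T_ideal p q r \<Longrightarrow> g \<in> T_ideal p q r \<Longrightarrow> f + g \<in> T_ideal p q r"
  and T_ideal_mult_left: "f \<in> T_ideal p q r \<Longrightarrow> g * f \<in> T_ideal p q r"
  and T_ideal_mult_right: "f \<in> T_ideal p q r \<Longrightarrow> f * g \<in> T_ideal p q r"
proof -
  interpret ideal "T_ideal p q r" free_algebra by (rule ideal_T_ideal)
  show "0 \<in> T_ideal p q r" "f \<in> T_ideal p q r \<Longrightarrow> g \<in> T_ideal p q r \<Longrightarrow> f + g \<in> T_ideal p q r"
    using additive_subgroup.zero_closed[OF additive_subgroup_axioms]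
      additive_subgroup.a_closed[OF additive_subgroup_axioms] by auto
  show "f \<in> T_ideal p q r \<Longrightarrow> g * f \<in> T_ideal p q r" "f \<in> T_ideal p q r \<Longrightarrow> f * g \<in> T_ideal p q r"
    using I_l_closed[of f g] I_r_closed[of f g] by auto
qed

lemma T_ideal_minus: "f \<in> T_ideal p q r \<Longrightarrow> - f \<in> T_ideal p q r"
  using T_ideal_mult_left[of f p q r "-1"] by simp

lemma T_ideal_diff: "f \<in> T_ideal p q r \<Longrightarrow> g \<in> T_ideal p q r \<Longrightarrow> f - g \<in> T_ideal p q r"
  using T_ideal_add[of f p q r "-g"] T_ideal_minus[of g p q r] by simp

text \<open>The elements killed by the evaluation form an ideal; it contains the relators, hence the
  ideal that they generate.\<close>

lemma T_ideal_eval_eq_0: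
  fixes \<phi> :: "generator \<Rightarrow> 'r::ring_1"
  assumes "central_embedding \<iota>"
    and rel: "\<And>g. g \<in> T_relators p q r \<Longrightarrow> free_eval \<iota> \<phi> g = 0"
    and "f \<in> T_ideal p q r"
  shows "free_eval \<iota> \<phi> f = 0"
proof -
  interpret central_embedding \<iota> by fact
  interpret ring free_algebra by (rule ring_free_algebra)
  have inv: "\<ominus>\<^bsub>free_algebra\<^esub> f = - f" for f :: "generator word \<Rightarrow>\<^sub>0 _"
    by (rule minus_equality) auto
  have "ideal {f. free_eval \<iota> \<phi> f = 0} free_algebra"
  proof (rule idealI[OF ring_free_algebra])
    show "subgroup {f. free_eval \<iota> \<phi> f = 0} (add_monoid free_algebra)"
      by (rule add.subgroupI)
        (auto simp: free_eval_add a_inv_def[symmetric] inv free_eval_minus intro: exI[of _ 0])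
  qed (auto simp: free_eval_mult)
  then have "T_ideal p q r \<subseteq> {f. free_eval \<iota> \<phi> f = 0}"
    unfolding T_ideal_def by (rule genideal_minimal) (auto simp: rel)
  then show ?thesis using assms(3) by auto
qed

lemma abelian_monoid_cong:
  assumes "abelian_monoid A"
    and "carrier B = carrier A" "add B = add A" "zero B = zero A"
  shows "abelian_monoid B"
proof -
  interpret abelian_monoid A by fact
  show ?thesis by (rule abelian_monoidI) (simp_all add: assms(2-) a_ac)
qed

text \<open>Every tuple in the quotient lifts to a tuple \<open>X\<close> in the free algebra, and
  the value of \<open>f\<close> at the cosets is the coset of its value at \<open>X\<close>.\<close>

lemma polynomial_identity_T_algebraI:
  fixes f :: "nat word \<Rightarrow>\<^sub>0 'k::field"
  assumes "f \<in> ncpolys m" and f: "\<And>X. free_eval scal X f \<in> T_ideal p q r"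
  shows "polynomial_identity (T_algebra p q r) m f"
proof -
  let ?F = "free_algebra :: ('k, generator word \<Rightarrow>\<^sub>0 'k) module" and ?T = "T_algebra p q r"
  let ?I = "T_ideal p q r"
  interpret ideal ?I ?F by (rule ideal_T_ideal)
  interpret Q: ring "?F Quot ?I" by (rule quotient_is_ring)
  interpret h: ring_hom_ring ?F "?F Quot ?I" "(+>\<^bsub>?F\<^esub>) ?I" by (rule rcos_ring_hom_ring)
  have T: "carrier ?T = carrier (?F Quot ?I)" "add ?T = add (?F Quot ?I)"
    "zero ?T = zero (?F Quot ?I)" "mult ?T = mult (?F Quot ?I)" "one ?T = one (?F Quot ?I)"
    "smult ?T c Y = (\<Union>g\<in>Y. ?I +>\<^bsub>?F\<^esub> (scal c * g))" for c Y
    by (simp_all add: T_algebra_def quotient_algebra_def T_ideal_def ring.defs monoid.defs)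
  have abelian: "abelian_monoid ?T"
    by (rule abelian_monoid_cong[OF Q.abelian_monoid_axioms T(1-3)])
  \<comment> \<open>Scalar multiplication on the quotient is a union over the representatives of a
    coset; the united cosets coincide because the ideal is stable under
    \<open>scal c\<close>.\<close>
  have smult: "?I +>\<^bsub>?F\<^esub> (scal c * g) = c \<odot>\<^bsub>?T\<^esub> (?I +>\<^bsub>?F\<^esub> g)" for c g
  proof -
    have "?I +>\<^bsub>?F\<^esub> (scal c * g') = ?I +>\<^bsub>?F\<^esub> (scal c * g)" if g': "g' \<in> ?I +>\<^bsub>?F\<^esub> g" for g'
    proof -
      obtain i where i: "i \<in> ?I" "g' = i + g" using g' by (auto simp: a_r_coset_def r_coset_def)
      have "scal c * i \<in> ?I" by (rule T_ideal_mult_left) fact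
      then have "scal c * g' \<in> ?I +>\<^bsub>?F\<^esub> (scal c * g)"
        by (auto simp: i(2) a_r_coset_def r_coset_def distrib_left)
      then show ?thesis using a_repr_independence'[of "scal c * g'" "scal c * g"] by simp
    qed
    moreover have "g \<in> ?I +>\<^bsub>?F\<^esub> g" by (rule a_rcos_self) simp
    ultimately show ?thesis unfolding T by blast
  qed
  show ?thesis
    unfolding polynomial_identity_def
  proof (intro conjI allI impI)
    fix x :: "nat \<Rightarrow> (generator word \<Rightarrow>\<^sub>0 'k) set"
    assume x: "\<forall>i\<in>{1..m}. x i \<in> carrier ?T"
    have "\<exists>g. Y = ?I +>\<^bsub>?F\<^esub> g" if "Y \<in> carrier ?T" for Y
      using that unfolding T by (auto simp: FactRing_def A_RCOSETS_def')
    with x have "\<forall>i. \<exists>g. i \<in> {1..m} \<longrightarrow> x i = ?I +>\<^bsub>?F\<^esub> g" by blast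
    then obtain X where X: "\<And>i. i \<in> {1..m} \<Longrightarrow> x i = ?I +>\<^bsub>?F\<^esub> X i" by metis
    have "ncpoly_eval ?T x f = ?I +>\<^bsub>?F\<^esub> (free_eval scal X f)"
    proof (rule ncpoly_eval_image[OF abelian])
      show "?I +>\<^bsub>?F\<^esub> u \<in> carrier ?T" for u unfolding T by (rule h.hom_closed) simp
      show "?I +>\<^bsub>?F\<^esub> (u + v) = (?I +>\<^bsub>?F\<^esub> u) \<oplus>\<^bsub>?T\<^esub> (?I +>\<^bsub>?F\<^esub> v)" for u v
        using h.hom_add[of u v] unfolding T by simp
      show "?I +>\<^bsub>?F\<^esub> (u * v) = (?I +>\<^bsub>?F\<^esub> u) \<otimes>\<^bsub>?T\<^esub> (?I +>\<^bsub>?F\<^esub> v)" for u v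
        using h.hom_mult[of u v] unfolding T by simp
      show "?I +>\<^bsub>?F\<^esub> 0 = \<zero>\<^bsub>?T\<^esub>" "?I +>\<^bsub>?F\<^esub> 1 = \<one>\<^bsub>?T\<^esub>"
        using h.hom_zero h.hom_one unfolding T by simp_all
      show "?I +>\<^bsub>?F\<^esub> (scal c * u) = c \<odot>\<^bsub>?T\<^esub> (?I +>\<^bsub>?F\<^esub> u)" for c u by (rule smult)
      show "x i = ?I +>\<^bsub>?F\<^esub> X i" if "w \<in> Poly_Mapping.keys f" "i \<in> set (letters w)" for w i
        using assms(1) that unfolding ncpolys_def by (intro X) blast
    qed
    also have "\<dots> = \<zero>\<^bsub>?T\<^esub>"
      unfolding T using a_rcos_const[OF f[of X]] by (simp add: FactRing_def)
    finally show "ncpoly_eval ?T x f = \<zero>\<^bsub>?T\<^esub>" .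
  qed fact
qed

section \<open>Six by six matrices\<close>

text \<open>Row vectors over these indices will form a free module of rank two over
  \<open>K[x]/(x\<^sup>3 - r)\<close>: the letter marks the generator, the digit the power of
  \<open>x\<close>.\<close>

datatype row_index = V0 | V1 | V2 | W0 | W1 | W2

lemma UNIV_row_index: "UNIV = {V0, V1, V2, W0, W1, W2}"
  using row_index.exhaust by blast

instance row_index :: finite
  by standard (simp add: UNIV_row_index)

lemma sum_row_index: "(\<Sum>i\<in>UNIV. f i) = f V0 + f V1 + f V2 + f W0 + f W1 + f W2"
  unfolding UNIV_row_index by (simp add: add.assoc)

lemma all_row_index: "(\<forall>i. P i) \<longleftrightarrow> P V0 \<and> P V1 \<and> P V2 \<and> P W0 \<and> P W1 \<and> P W2"
  by (metis row_index.exhaust)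

text \<open>A separate type makes the matrices an instance of \<open>ring_1\<close>, and the six
  named indices let products be expanded entry by entry.\<close>

typedef 'k mat6 = "UNIV :: (row_index \<Rightarrow> row_index \<Rightarrow> 'k) set"
  morphisms entry Mat6 ..

setup_lifting type_definition_mat6

lemma mat6_eqI: "(\<And>i j. entry A i j = entry B i j) \<Longrightarrow> A = B"
  by (simp add: entry_inject[symmetric] fun_eq_iff)

lemma entry_Mat6 [simp]: "entry (Mat6 M) = M"
  by (simp add: Mat6_inverse)

instantiation mat6 :: (comm_ring_1) ring_1
begin

lift_definition zero_mat6 :: "'a mat6" is "\<lambda>i j. 0" .
lift_definition one_mat6 :: "'a mat6" is "\<lambda>i j. if i = j then 1 else 0" .
lift_definition plus_mat6 :: "'a mat6 \<Rightarrow> 'a mat6 \<Rightarrow> 'a mat6" is "\<lambda>A B i j. A i j + B i j" .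
lift_definition minus_mat6 :: "'a mat6 \<Rightarrow> 'a mat6 \<Rightarrow> 'a mat6" is "\<lambda>A B i j. A i j - B i j" .
lift_definition uminus_mat6 :: "'a mat6 \<Rightarrow> 'a mat6" is "\<lambda>A i j. - A i j" .
lift_definition times_mat6 :: "'a mat6 \<Rightarrow> 'a mat6 \<Rightarrow> 'a mat6" is
  "\<lambda>A B i j. \<Sum>l\<in>UNIV. A i l * B l j" .

instance
proof
  fix A B C :: "'a mat6"
  show "A * B * C = A * (B * C)"
    by transfer (simp add: sum_row_index algebra_simps)
  show "1 * A = A" "A * 1 = A"
    by (transfer; simp add: if_distrib[of "\<lambda>u. u * _"] if_distrib[of "\<lambda>u. _ * u"] cong: if_cong)+
  show "(0::'a mat6) \<noteq> 1" by transfer (auto simp: fun_eq_iff)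
qed (transfer; simp add: algebra_simps sum.distrib)+

end

lift_definition scalar6 :: "'k::comm_ring_1 \<Rightarrow> 'k mat6" is "\<lambda>c i j. if i = j then c else 0" .

lemma entry_simps:
  "entry (0 :: 'k::comm_ring_1 mat6) i j = 0"
  "entry (1 :: 'k mat6) i j = (if i = j then 1 else 0)"
  "entry (A + B :: 'k mat6) i j = entry A i j + entry B i j"
  "entry (A - B :: 'k mat6) i j = entry A i j - entry B i j"
  "entry (- A :: 'k mat6) i j = - entry A i j"
  "entry (A * B :: 'k mat6) i j = (\<Sum>l\<in>UNIV. entry A i l * entry B l j)"
  "entry (scalar6 c :: 'k mat6) i j = (if i = j then c else 0)"
  by (transfer; simp)+

lemma entry_scalar6_mult: "entry (scalar6 c * A) i j = c * entry A i j"
  by (simp add: entry_simps if_distrib[of "\<lambda>u. u * _"] cong: if_cong)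

interpretation scalar6: central_embedding "scalar6 :: 'k::field \<Rightarrow> 'k mat6"
proof
  fix c :: 'k and A :: "'k mat6"
  show "scalar6 c * A = A * scalar6 c"
    by (rule mat6_eqI) (simp add: entry_simps if_distrib[of "\<lambda>u. u * _"] if_distrib[of "\<lambda>u. _ * u"]
        mult.commute cong: if_cong)
qed (rule mat6_eqI, simp add: entry_simps if_distrib[of "\<lambda>u. u * _"] cong: if_cong)+

text \<open>The identity of the product is applied to the diagonal tuple \<open>(Y i, Y i)\<close>;
  either component of the result is the value at \<open>Y\<close>.\<close>

lemma polynomial_identity_mat6:
  fixes f :: "nat word \<Rightarrow>\<^sub>0 'k::field"
  assumes "polynomial_identity
      (algebra_prod (module_mat TYPE('k) 6 6) (module_mat TYPE('k) 6 6)) m f"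
  shows "free_eval scalar6 Y f = 0"
proof -
  let ?M = "module_mat TYPE('k) 6 6"
  let ?P = "algebra_prod ?M ?M"
  define row where "row i = [V0, V1, V2, W0, W1, W2] ! i" for i
  define h1 where "h1 A = mat 6 6 (\<lambda>(i, j). entry A (row i) (row j))" for A :: "'k mat6"
  define h where "h A = (h1 A, h1 A)" for A
  have row_surj: "\<exists>i<6. row i = l" for l
    by (cases l; simp add: row_def; (rule exI[of _ 0] exI[of _ 1] exI[of _ 2] exI[of _ 3]
        exI[of _ 4] exI[of _ 5], simp; fail))
  have row_inj: "row i = row j \<longleftrightarrow> i = j" if "i < 6" "j < 6" for i j
    using that by (auto simp: row_def nth_eq_iff_index_eq)
  have sum_row: "(\<Sum>l\<in>UNIV. g l) = (\<Sum>l = 0..<6. g (row l))" for g :: "row_index \<Rightarrow> 'k"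
    by (simp add: sum_row_index row_def numeral_eq_Suc add.assoc)
  have ring: "ring ?M"
    by (unfold_locales, insert add_inv_exists_mat, auto simp: module_mat_def algebra_simps Units_def)
  have P: "carrier ?P = carrier (RDirProd ?M ?M)" "add ?P = add (RDirProd ?M ?M)"
    "zero ?P = zero (RDirProd ?M ?M)"
    by (simp_all add: algebra_prod_def ring.defs)
  have "abelian_monoid (RDirProd ?M ?M)"
    by (intro abelian_group.axioms ring.axioms(1) RDirProd_ring ring)
  from abelian_monoid_cong[OF this P] have abelian: "abelian_monoid ?P" .
  have smult: "h (scalar6 c * A) = c \<odot>\<^bsub>?P\<^esub> h A" for c A
    by (auto simp: h_def h1_def algebra_prod_def ring.defs module_mat_def entry_scalar6_mult)
  have eval: "ncpoly_eval ?P (\<lambda>i. h (Y i)) f = h (free_eval scalar6 Y f)"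
    by (rule ncpoly_eval_image[OF abelian _ _ _ _ _ smult])
      (auto simp: P h_def h1_def algebra_prod_def ring.defs RDirProd_def DirProd_def monoid.defs
        module_mat_def entry_simps scalar_prod_def sum_row row_inj intro!: eq_matI)
  have "h A \<in> carrier ?P" for A
    unfolding P RDirProd_carrier by (simp add: h_def h1_def module_mat_def)
  then have "ncpoly_eval ?P (\<lambda>i. h (Y i)) f = \<zero>\<^bsub>?P\<^esub>"
    using assms[unfolded polynomial_identity_def, THEN conjunct2, rule_format] by simp
  moreover have "\<zero>\<^bsub>?P\<^esub> = (0\<^sub>m 6 6, 0\<^sub>m 6 6)"
    unfolding P by (simp add: RDirProd_def DirProd_def monoid.defs module_mat_def)
  ultimately have 0: "h1 (free_eval scalar6 Y f) = 0\<^sub>m 6 6"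
    using eval by (simp add: h_def)
  have "entry (free_eval scalar6 Y f) (row i) (row j) = 0" if "i < 6" "j < 6" for i j
    using arg_cong[OF 0, of "\<lambda>M. M $$ (i, j)"] that by (simp add: h1_def)
  then show ?thesis by (intro mat6_eqI) (metis row_surj entry_simps(1))
qed

section \<open>A spanning set of 72 words\<close>

text \<open>The reduced words of the symmetric group on three letters in two transpositions. The
  elements \<open>a\<close> and \<open>b\<close> will satisfy a deformation of its
  relations.\<close>

definition core_word :: "'r::monoid_mult \<Rightarrow> 'r \<Rightarrow> nat \<Rightarrow> 'r" where
  "core_word a b i = [1, a, b, a * b, b * a, a * b * a] ! i"

fun spanning_word :: "'r::monoid_mult \<Rightarrow> 'r \<Rightarrow> 'r \<Rightarrow> 'r \<Rightarrow> nat \<times> nat \<times> nat \<Rightarrow> 'r" where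
  "spanning_word a b c x (i, e, j) = core_word a b i * c ^ e * x ^ j"

definition word_indices :: "(nat \<times> nat \<times> nat) set" where
  "word_indices = {..<6} \<times> {..<2} \<times> {..<3}"

text \<open>Coefficients form a set of central elements rather than a field, so that polynomial
  functions of the parameters qualify as well as scalar matrices. The sort
  \<open>{ring,monoid_mult}\<close> does not demand \<open>0 \<noteq> 1\<close>, which is not known
  for the universal family at the time of use.\<close>

locale central_coefficients =
  fixes K :: "'r::{ring,monoid_mult} set"
  assumes K_central: "k \<in> K \<Longrightarrow> k * u = u * k"
    and K_add: "k \<in> K \<Longrightarrow> l \<in> K \<Longrightarrow> k + l \<in> K"
    and K_mult: "k \<in> K \<Longrightarrow> l \<in> K \<Longrightarrow> k * l \<in> K"
    and K_0: "0 \<in> K" and K_1: "1 \<in> K" and K_minus_1: "- 1 \<in> K"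
begin

inductive_set K_span :: "'r set \<Rightarrow> 'r set" for B where
  K_span_0: "0 \<in> K_span B"
| K_span_step: "k \<in> K \<Longrightarrow> b \<in> B \<Longrightarrow> y \<in> K_span B \<Longrightarrow> k * b + y \<in> K_span B"

lemma K_span_add: "y \<in> K_span B \<Longrightarrow> z \<in> K_span B \<Longrightarrow> y + z \<in> K_span B"
  by (induction rule: K_span.induct) (auto simp: add.assoc intro: K_span_step)

lemma K_span_smult: "y \<in> K_span B \<Longrightarrow> k \<in> K \<Longrightarrow> k * y \<in> K_span B"
proof (induction rule: K_span.induct)
  case (K_span_step l b y)
  then have "(k * l) * b + k * y \<in> K_span B" by (intro K_span.K_span_step K_mult)
  then show ?case by (simp add: distrib_left mult.assoc)
qed (simp add: K_span_0)

lemma K_span_base: "b \<in> B \<Longrightarrow> b \<in> K_span B"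
  using K_span_step[OF K_1 _ K_span_0, of b B] by simp

lemma K_span_minus: "y \<in> K_span B \<Longrightarrow> - y \<in> K_span B"
  using K_span_smult[OF _ K_minus_1] by fastforce

lemma K_span_diff: "y \<in> K_span B \<Longrightarrow> z \<in> K_span B \<Longrightarrow> y - z \<in> K_span B"
  using K_span_add[of y B "- z"] K_span_minus[of z B] by simp

lemma K_span_mult_right:
  assumes "y \<in> K_span B" "\<And>b. b \<in> B \<Longrightarrow> b * g \<in> K_span C"
  shows "y * g \<in> K_span C"
  using assms(1)
  by induction (auto simp: distrib_right mult.assoc intro: K_span_0 K_span_add K_span_smult assms(2))

text \<open>Coefficients are indexed by \<open>J\<close> and not by the words, so distinct indices
  with equal words do no harm.\<close>

lemma K_span_image_sum:
  assumes "y \<in> K_span (w ` J)" "finite J"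
  obtains \<kappa> where "\<And>j. \<kappa> j \<in> K" "y = (\<Sum>j\<in>J. \<kappa> j * w j)"
proof -
  have "\<exists>\<kappa>. (\<forall>j. \<kappa> j \<in> K) \<and> y = (\<Sum>j\<in>J. \<kappa> j * w j)"
    using assms(1)
  proof induction
    case K_span_0
    show ?case by (rule exI[of _ "\<lambda>_. 0"]) (simp add: K_0)
  next
    case (K_span_step k b y)
    then obtain i \<kappa> where i: "i \<in> J" "b = w i"
      and \<kappa>: "\<forall>j. \<kappa> j \<in> K" "y = (\<Sum>j\<in>J. \<kappa> j * w j)" by auto
    have "k * b + y = (\<Sum>j\<in>J. (if j = i then k * w j else 0)) + (\<Sum>j\<in>J. \<kappa> j * w j)"
      using assms(2) i \<kappa>(2) by simp
    also have "\<dots> = (\<Sum>j\<in>J. ((if j = i then k else 0) + \<kappa> j) * w j)"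
      unfolding sum.distrib[symmetric] by (rule sum.cong) (auto simp: distrib_right)
    finally show ?case
      using \<kappa>(1) K_span_step(1)
      by (intro exI[of _ "\<lambda>j. (if j = i then k else 0) + \<kappa> j"]) (auto intro!: K_add K_0)
  qed
  then show ?thesis using that by blast
qed

end

section \<open>Rewriting by the defining relations\<close>

locale T_relations = central_coefficients K
  for K :: "'r::{ring,monoid_mult} set" +
  fixes p q r a b c d x :: 'r
  assumes p: "p \<in> K" and q: "q \<in> K" and r: "r \<in> K"
    and aa: "a * a = p" and bb: "b * b = p" and cc: "c * c = p" and dd: "d * d = p"
    and ca: "c * a = q - b * c - a * b"
    and da: "d * a = q - c * d - a * c"
    and db: "d * b = q - b * a - a * d"
    and dc: "d * c = q - c * b - b * d"
    and x_def: "x = c * b + b * a + a * c - q"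
    and xxx: "x ^ 3 = r"
begin

lemma qc: "u * q = q * u" and pc: "u * p = p * u" and rc: "u * r = r * u"
  using K_central[OF p] K_central[OF q] K_central[OF r] by simp_all

lemma central_simps:
  "a * p = p * a" "b * p = p * b" "c * p = p * c" "d * p = p * d"
  "a * q = q * a" "b * q = q * b" "c * q = q * c" "d * q = q * d"
  "a * (p * u) = p * (a * u)" "b * (p * u) = p * (b * u)"
  "c * (p * u) = p * (c * u)" "d * (p * u) = p * (d * u)"
  "a * (q * u) = q * (a * u)" "b * (q * u) = q * (b * u)"
  "c * (q * u) = q * (c * u)" "d * (q * u) = q * (d * u)"
  "q * p = p * q" "q * (p * u) = p * (q * u)"
  by (rule pc | rule qc | metis pc qc mult.assoc)+

lemma square_assoc: "a * (a * u) = p * u" "b * (b * u) = p * u" "c * (c * u) = p * u" "d * (d * u) = p * u"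
  using aa bb cc dd by (simp_all add: mult.assoc[symmetric])

text \<open>Multiplying \<open>ca\<close> by \<open>a\<close> on the right and by \<open>b\<close>
  on the left gives two equations containing \<open>b * c * a\<close>; eliminating it leaves a
  deformed braid relation. The next two lemmas eliminate \<open>c * a * b\<close> and
  \<open>a * b * c\<close> in the same way.\<close>

lemma aba_bab: "b * a * b = a * b * a + q * b - q * a"
  using arg_cong[OF ca, of "\<lambda>u. u * a"] arg_cong[OF ca, of "\<lambda>u. b * u"]
  by (simp add: algebra_simps square_assoc central_simps aa)

lemma bcb_cbc: "c * b * c = b * c * b + q * c - q * b"
  using arg_cong[OF ca, of "\<lambda>u. u * b"] arg_cong[OF ca, of "\<lambda>u. c * u"]
  by (simp add: algebra_simps square_assoc central_simps bb) (drule sym, drule sym, simp add: add_ac)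

lemma aca_cac: "a * c * a = c * a * c + q * a - q * c"
  using arg_cong[OF ca, of "\<lambda>u. u * c"] arg_cong[OF ca, of "\<lambda>u. a * u"]
  by (simp add: algebra_simps square_assoc central_simps cc) (drule sym, drule sym, simp add: add_ac)

text \<open>The braid relation replaces \<open>a * c * a\<close> by \<open>c * a * c\<close>, after
  which \<open>c\<close> factors out on the left. By this lemma and the next two, passing
  \<open>x\<close> permutes the letters \<open>a\<close>, \<open>b\<close>, \<open>c\<close>
  cyclically.\<close>

lemma xa: "x * a = c * x"
proof -
  have "x * a = c * b * a + b * p + a * c * a - q * a"
    unfolding x_def by (simp add: algebra_simps aa)
  also have "\<dots> = c * x"
    unfolding x_def aca_cac by (simp add: algebra_simps square_assoc central_simps)
  finally show ?thesis .
qed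

lemma xb: "x * b = a * x"
proof -
  have "x * b = c * p + b * a * b + a * c * b - q * b"
    unfolding x_def by (simp add: algebra_simps bb)
  also have "\<dots> = a * x"
    unfolding x_def aba_bab by (simp add: algebra_simps square_assoc central_simps)
  finally show ?thesis .
qed

lemma xc: "x * c = b * x"
proof -
  have "x * c = c * b * c + b * a * c + a * p - q * c"
    unfolding x_def by (simp add: algebra_simps cc)
  also have "\<dots> = b * x"
    unfolding x_def bcb_cbc by (simp add: algebra_simps square_assoc central_simps)
  finally show ?thesis .
qed

definition U :: "'r set" where "U = core_word a b ` {..<6}"

lemma U_eq: "U = {1, a, b, a * b, b * a, a * b * a}"
proof -
  have "{..<6::nat} = {0, 1, 2, 3, 4, 5}" by auto
  then show ?thesis unfolding U_def by (simp add: core_word_def)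
qed

lemma U_in: "u \<in> U \<Longrightarrow> u \<in> K_span U" by (rule K_span_base)

lemma core_mult:
  assumes "y \<in> K_span U"
  shows "y * a \<in> K_span U" and "y * b \<in> K_span U"
proof -
  have U: "1 \<in> K_span U" "a \<in> K_span U" "b \<in> K_span U" "a * b \<in> K_span U" "b * a \<in> K_span U"
    "a * b * a \<in> K_span U"
    by (auto intro!: K_span_base simp: U_eq)
  note S = U K_span_smult[OF U(1) p] K_span_smult[OF U(2) p] K_span_smult[OF U(3) p]
    K_span_smult[OF U(4) p] K_span_smult[OF U(5) p]
  have "a * b * a * a = p * (a * b)" "b * a * a = p * b" "a * b * b = p * a"
    by (simp_all add: mult.assoc aa bb central_simps)
  moreover have "b * a * b \<in> K_span U"
    unfolding aba_bab by (intro K_span_add K_span_diff K_span_smult[OF _ q] U)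
  \<comment> \<open>Left multiplication of \<open>aba_bab\<close> by \<open>a\<close> reduces the
    longest word. The product \<open>p * 1\<close> is kept so that the last term is visibly a
    coefficient times the word \<open>1\<close>.\<close>
  moreover have "a * b * a * b = p * (b * a) + q * (a * b) - q * (p * 1)"
    using arg_cong[OF aba_bab, of "\<lambda>u. a * u"]
    by (simp add: algebra_simps square_assoc central_simps aa)
  then have "a * b * a * b \<in> K_span U"
    by (auto intro!: K_span_add K_span_diff K_span_smult[OF _ q] S simp del: mult_1_right)
  ultimately have "u * a \<in> K_span U \<and> u * b \<in> K_span U" if "u \<in> U" for u
    using that S unfolding U_eq by (auto simp: aa bb)
  then show "y * a \<in> K_span U" "y * b \<in> K_span U"
    using K_span_mult_right[OF assms] by blast+
qed

definition W :: "'r set" where "W = spanning_word a b c x ` word_indices"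

lemma W_mem: "u \<in> U \<Longrightarrow> e < 2 \<Longrightarrow> j < 3 \<Longrightarrow> u * c ^ e * x ^ j \<in> W"
  unfolding W_def U_def word_indices_def by force

lemma W_cases:
  assumes "w \<in> W"
  obtains u e j where "u \<in> U" "e < 2" "j < 3" "w = u * c ^ e * x ^ j"
  using assms unfolding W_def U_def word_indices_def by force

lemma core_power_mem: "y \<in> K_span U \<Longrightarrow> e < 2 \<Longrightarrow> j < 3 \<Longrightarrow> y * c ^ e * x ^ j \<in> K_span W"
  unfolding mult.assoc
  by (erule K_span_mult_right) (simp add: mult.assoc[symmetric] K_span_base W_mem)

lemma core_power_mem0: "y \<in> K_span U \<Longrightarrow> j < 3 \<Longrightarrow> y * x ^ j \<in> K_span W"
  using core_power_mem[of y 0 j] by simp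

lemma core_power_mem1: "y \<in> K_span U \<Longrightarrow> j < 3 \<Longrightarrow> y * c * x ^ j \<in> K_span W"
  using core_power_mem[of y 1 j] by simp

text \<open>The exponent of \<open>x\<close> wraps around: at \<open>j = 2\<close> the new power is
  the central element \<open>r\<close>.\<close>

lemma core_power_Suc_mem:
  assumes "y \<in> K_span U" "j < 3"
  shows "y * x * x ^ j \<in> K_span W"
proof (cases "j = 2")
  case True
  have "x * x ^ 2 = r" using xxx by (simp add: eval_nat_numeral)
  then have "y * x * x ^ j = r * y" using True by (simp add: mult.assoc rc)
  then show ?thesis using K_span_smult[OF core_power_mem0[OF assms(1), of 0] r] by simp
next
  case False
  then show ?thesis using core_power_mem0[of y "Suc j"] assms by (simp add: mult.assoc)
qed

text \<open>A letter after \<open>c\<close> is removed by \<open>ca\<close>, by the definition of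
  \<open>x\<close> solved for \<open>c * b\<close>, or by \<open>cc\<close>. The second case is what
  brings powers of \<open>x\<close> into the words.\<close>

lemma core_c_mult:
  assumes y: "y \<in> K_span U" and "e < 2" "j < 3" and g: "g \<in> {a, b, c}"
  shows "y * c ^ e * g * x ^ j \<in> K_span W"
proof -
  have yq: "y * (q * u) = q * (y * u)" for u by (metis mult.assoc qc)
  have cb: "c * b = x - b * a - a * c + q" by (simp add: x_def)
  have "e = 0 \<or> e = 1" using assms by auto
  moreover have "y * g * x ^ j \<in> K_span W"
    using g core_power_mem0[OF core_mult(1)[OF y] \<open>j < 3\<close>] core_power_mem0[OF core_mult(2)[OF y] \<open>j < 3\<close>]
      core_power_mem1[OF y \<open>j < 3\<close>] by auto
  moreover have "y * c * a * x ^ j = q * (y * x ^ j) - y * b * c * x ^ j - y * a * b * x ^ j"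
    using arg_cong[OF ca, of "\<lambda>u. y * u * x ^ j"] by (simp add: algebra_simps yq)
  then have "y * c * a * x ^ j \<in> K_span W"
    using \<open>j < 3\<close> y
    by (auto intro!: K_span_diff K_span_smult[OF _ q] core_power_mem0 core_power_mem1 core_mult)
  moreover have "y * c * b * x ^ j = y * x * x ^ j - y * b * a * x ^ j - y * a * c * x ^ j + q * (y * x ^ j)"
    using arg_cong[OF cb, of "\<lambda>u. y * u * x ^ j"] by (simp add: algebra_simps yq)
  then have "y * c * b * x ^ j \<in> K_span W"
    using \<open>j < 3\<close> y
    by (auto intro!: K_span_diff K_span_add K_span_smult[OF _ q] core_power_mem0 core_power_mem1
        core_mult core_power_Suc_mem)
  moreover have "y * c * c * x ^ j = p * (y * x ^ j)"
    by (metis cc mult.assoc pc)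
  then have "y * c * c * x ^ j \<in> K_span W"
    using \<open>j < 3\<close> y by (auto intro!: K_span_smult[OF _ p] core_power_mem0)
  ultimately show ?thesis using g by auto
qed

lemma x_power_shift: "g \<in> {a, b, c} \<Longrightarrow> \<exists>g'\<in>{a, b, c}. x ^ j * g = g' * x ^ j"
proof (induction j arbitrary: g)
  case (Suc j)
  have "\<exists>g'\<in>{a, b, c}. x * g = g' * x" using Suc.prems xa xb xc by auto
  then obtain g' where g': "g' \<in> {a, b, c}" "x * g = g' * x" by blast
  from Suc.IH[OF g'(1)] obtain g'' where "g'' \<in> {a, b, c}" "x ^ j * g' = g'' * x ^ j" by blast
  then show ?case using g'(2) by (metis mult.assoc power_Suc2)
qed auto

text \<open>The new letter moves left across \<open>x ^ j\<close>, turning into another of the three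
  letters, and \<open>core_c_mult\<close> absorbs it there.\<close>

lemma W_mult:
  assumes "y \<in> K_span W" and g: "g \<in> {a, b, c}"
  shows "y * g \<in> K_span W"
proof (rule K_span_mult_right[OF assms(1)])
  fix w assume "w \<in> W"
  then obtain u e j where w: "u \<in> U" "e < 2" "j < 3" "w = u * c ^ e * x ^ j" by (rule W_cases)
  obtain g' where "g' \<in> {a, b, c}" "x ^ j * g = g' * x ^ j" using x_power_shift[OF g] by blast
  then show "w * g \<in> K_span W"
    using core_c_mult[OF U_in[OF w(1)] w(2,3), of g'] w(4) by (simp add: mult.assoc)
qed

definition Z :: "'r set" where "Z = (\<lambda>(i, f). spanning_word a b c x i * d ^ f) ` (word_indices \<times> {..<2})"

lemma Z_mem: "w \<in> W \<Longrightarrow> w \<in> Z" "w \<in> W \<Longrightarrow> w * d \<in> Z"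
proof -
  assume "w \<in> W"
  then obtain i where i: "i \<in> word_indices" "w = spanning_word a b c x i" unfolding W_def by blast
  show "w \<in> Z" unfolding Z_def using i by (intro image_eqI[of _ _ "(i, 0)"]) auto
  show "w * d \<in> Z" unfolding Z_def using i by (intro image_eqI[of _ _ "(i, 1)"]) auto
qed

lemma Z_cases:
  assumes "z \<in> Z"
  obtains w where "w \<in> W" "z = w \<or> z = w * d"
proof -
  obtain t where "t \<in> word_indices \<times> {..<2}" "z = (\<lambda>(i, f). spanning_word a b c x i * d ^ f) t"
    using assms unfolding Z_def by blast
  then obtain i f where "i \<in> word_indices" "f < 2" "z = spanning_word a b c x i * d ^ f"
    by (cases t) (auto simp del: spanning_word.simps)
  moreover have "f = 0 \<or> f = 1" using \<open>f < 2\<close> by auto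
  ultimately show ?thesis using that[of "spanning_word a b c x i"] unfolding W_def by auto
qed

lemma W_span_Z: "y \<in> K_span W \<Longrightarrow> y \<in> K_span Z" "y \<in> K_span W \<Longrightarrow> y * d \<in> K_span Z"
  using K_span_mult_right[of y W 1 Z] K_span_mult_right[of y W d Z] K_span_base Z_mem by auto

text \<open>The relations \<open>da\<close>, \<open>db\<close>, \<open>dc\<close> are oriented so
  that \<open>d\<close> moves to the right end or disappears, and \<open>dd\<close> bounds its
  exponent.\<close>

lemma Z_mult:
  assumes "y \<in> K_span Z" and g: "g \<in> {a, b, c, d}"
  shows "y * g \<in> K_span Z"
proof (rule K_span_mult_right[OF assms(1)])
  fix z assume "z \<in> Z"
  then obtain w where w: "w \<in> W" "z = w \<or> z = w * d" by (rule Z_cases)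
  have wW: "w \<in> K_span W" using w(1) by (rule K_span_base)
  have "w * g \<in> K_span Z"
    using g W_mult[OF wW, THEN W_span_Z(1), of g] W_span_Z(2)[OF wW] by auto
  moreover have "w * d * g \<in> K_span Z"
  proof -
    have wgd: "w * u * d \<in> K_span Z" if "u \<in> {a, b, c}" for u
      by (rule W_span_Z(2)[OF W_mult[OF wW that]])
    have wgg: "w * u * v \<in> K_span Z" if "u \<in> {a, b, c}" "v \<in> {a, b, c}" for u v
      by (rule W_span_Z(1)[OF W_mult[OF W_mult[OF wW that(1)] that(2)]])
    have "w * d * a = q * w - w * c * d - w * a * c"
      using arg_cong[OF da, of "\<lambda>u. w * u"] by (simp add: algebra_simps qc)
    then have 1: "w * d * a \<in> K_span Z"
      by (simp add: K_span_diff K_span_smult[OF _ q] W_span_Z(1)[OF wW] wgd wgg)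
    have "w * d * b = q * w - w * b * a - w * a * d"
      using arg_cong[OF db, of "\<lambda>u. w * u"] by (simp add: algebra_simps qc)
    then have 2: "w * d * b \<in> K_span Z"
      by (simp add: K_span_diff K_span_smult[OF _ q] W_span_Z(1)[OF wW] wgd wgg)
    have "w * d * c = q * w - w * c * b - w * b * d"
      using arg_cong[OF dc, of "\<lambda>u. w * u"] by (simp add: algebra_simps qc)
    then have 3: "w * d * c \<in> K_span Z"
      by (simp add: K_span_diff K_span_smult[OF _ q] W_span_Z(1)[OF wW] wgd wgg)
    have "w * d * d = p * w" by (simp add: mult.assoc dd pc)
    then have "w * d * d \<in> K_span Z" by (auto intro!: K_span_smult[OF _ p] W_span_Z wW)
    with 1 2 3 g show ?thesis by auto
  qed
  ultimately show "z * g \<in> K_span Z" using w(2) by auto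
qed

lemma one_in_Z_span: "1 \<in> K_span Z"
  using W_mem[of 1 0 0] by (intro K_span_base Z_mem(1)) (simp add: U_eq)

end

section \<open>Polynomial dependence on the parameters\<close>

text \<open>The universal algebra over the ring of all functions of the three parameters. Working in it
  keeps track of the dependence of coefficients on the parameters.\<close>

quotient_type (overloaded) 'k T_family =
    "'k::field \<Rightarrow> 'k \<Rightarrow> 'k \<Rightarrow> (generator word \<Rightarrow>\<^sub>0 'k)" /
    "\<lambda>f g. \<forall>p q r. f p q r - g p q r \<in> T_ideal p q r"
proof (rule equivpI)
  show "reflp (\<lambda>f g. \<forall>p q r :: 'k. f p q r - g p q r \<in> T_ideal p q r)"
    by (simp add: reflp_def T_ideal_0)
  have "g - f \<in> T_ideal p q r" if "f - g \<in> T_ideal p q r" for f g and p q r :: 'k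
    using T_ideal_minus[OF that] by simp
  then show "symp (\<lambda>f g. \<forall>p q r :: 'k. f p q r - g p q r \<in> T_ideal p q r)"
    unfolding symp_def by blast
  have "f - h \<in> T_ideal p q r" if "f - g \<in> T_ideal p q r" "g - h \<in> T_ideal p q r"
    for f g h and p q r :: 'k
    using T_ideal_add[OF that] by simp
  then show "transp (\<lambda>f g. \<forall>p q r :: 'k. f p q r - g p q r \<in> T_ideal p q r)"
    unfolding transp_def by blast
qed

instantiation T_family :: (field) "{ring, monoid_mult}"
begin

lift_definition zero_T_family :: "'a T_family" is "\<lambda>p q r. 0" .
lift_definition one_T_family :: "'a T_family" is "\<lambda>p q r. 1" .
lift_definition plus_T_family :: "'a T_family \<Rightarrow> 'a T_family \<Rightarrow> 'a T_family"
  is "\<lambda>f g p q r. f p q r + g p q r"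
  by (metis T_ideal_add add_diff_add)
lift_definition uminus_T_family :: "'a T_family \<Rightarrow> 'a T_family" is "\<lambda>f p q r. - f p q r"
  by (metis T_ideal_minus minus_diff_minus)
lift_definition minus_T_family :: "'a T_family \<Rightarrow> 'a T_family \<Rightarrow> 'a T_family"
  is "\<lambda>f g p q r. f p q r - g p q r"
proof -
  fix f f' g g' :: "'a \<Rightarrow> 'a \<Rightarrow> 'a \<Rightarrow> (generator word \<Rightarrow>\<^sub>0 'a)" and p q r
  assume "\<And>p q r. f p q r - f' p q r \<in> T_ideal p q r" "\<And>p q r. g p q r - g' p q r \<in> T_ideal p q r"
  then have "(f p q r - f' p q r) - (g p q r - g' p q r) \<in> T_ideal p q r" by (rule T_ideal_diff)
  then show "(f p q r - g p q r) - (f' p q r - g' p q r) \<in> T_ideal p q r"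
    by (simp add: algebra_simps)
qed
lift_definition times_T_family :: "'a T_family \<Rightarrow> 'a T_family \<Rightarrow> 'a T_family"
  is "\<lambda>f g p q r. f p q r * g p q r"
proof -
  fix f f' g g' :: "'a \<Rightarrow> 'a \<Rightarrow> 'a \<Rightarrow> (generator word \<Rightarrow>\<^sub>0 'a)" and p q r
  assume "\<And>p q r. f p q r - f' p q r \<in> T_ideal p q r" "\<And>p q r. g p q r - g' p q r \<in> T_ideal p q r"
  then have "(f p q r - f' p q r) * g p q r + f' p q r * (g p q r - g' p q r) \<in> T_ideal p q r"
    by (intro T_ideal_add T_ideal_mult_left T_ideal_mult_right)
  then show "f p q r * g p q r - f' p q r * g' p q r \<in> T_ideal p q r"
    by (simp add: algebra_simps)
qed

instance
  by standard (transfer; simp add: algebra_simps T_ideal_0)+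

end

text \<open>Functions instead of formal polynomials in three variables: they are only ever
  restricted to a line, where an honest polynomial in one variable is recovered.\<close>

inductive_set poly_functions :: "('k::comm_ring_1 \<Rightarrow> 'k \<Rightarrow> 'k \<Rightarrow> 'k) set" where
  const: "(\<lambda>p q r. c) \<in> poly_functions"
| fst: "(\<lambda>p q r. p) \<in> poly_functions"
| snd: "(\<lambda>p q r. q) \<in> poly_functions"
| thd: "(\<lambda>p q r. r) \<in> poly_functions"
| add: "f \<in> poly_functions \<Longrightarrow> g \<in> poly_functions \<Longrightarrow> (\<lambda>p q r. f p q r + g p q r) \<in> poly_functions"
| mult: "f \<in> poly_functions \<Longrightarrow> g \<in> poly_functions \<Longrightarrow> (\<lambda>p q r. f p q r * g p q r) \<in> poly_functions"

lift_definition family_scalar :: "('k::field \<Rightarrow> 'k \<Rightarrow> 'k \<Rightarrow> 'k) \<Rightarrow> 'k T_family" is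
  "\<lambda>c p q r. scal (c p q r)" .

definition family_const :: "(generator word \<Rightarrow>\<^sub>0 'k::field) \<Rightarrow> 'k T_family" where
  "family_const f = abs_T_family (\<lambda>p q r. f)"

lemmas T_family_simps = family_const_def family_scalar.abs_eq plus_T_family.abs_eq
  times_T_family.abs_eq minus_T_family.abs_eq uminus_T_family.abs_eq
  zero_T_family.abs_eq one_T_family.abs_eq

lemma family_const_add: "family_const (f + g) = family_const f + family_const g"
  and family_const_mult: "family_const (f * g) = family_const f * family_const g"
  and family_const_1: "family_const 1 = 1"
  and family_const_scal: "family_const (scal c) = family_scalar (\<lambda>p q r. c)"
  by (simp_all add: T_family_simps)

text \<open>The parameters become the three coordinate functions and the coefficients all polynomial
  functions, so one rewriting argument treats all parameters at once and yields coefficients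
  polynomial in them.\<close>

interpretation family: T_relations "family_scalar ` poly_functions"
  "family_scalar (\<lambda>p q r. p)" "family_scalar (\<lambda>p q r. q)" "family_scalar (\<lambda>p q r. r)"
  "family_const (gen GenA)" "family_const (gen GenB)" "family_const (gen GenC)" "family_const (gen GenD)"
  "family_const (gen GenC * gen GenB + gen GenB * gen GenA + gen GenA * gen GenC)
     - family_scalar (\<lambda>p q r. q :: 'k::field)"
proof
  fix k l u :: "'k T_family"
  assume k: "k \<in> family_scalar ` poly_functions"
  then obtain c where c: "c \<in> poly_functions" "k = family_scalar c" by blast
  show "k * u = u * k"
    unfolding c(2) by transfer (simp add: scal_central T_ideal_0)
  assume "l \<in> family_scalar ` poly_functions"
  then obtain e where e: "e \<in> poly_functions" "l = family_scalar e" by blast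
  have "k + l = family_scalar (\<lambda>p q r. c p q r + e p q r)"
    unfolding c e by transfer (simp add: scal.\<iota>_add T_ideal_0)
  then show "k + l \<in> family_scalar ` poly_functions" using c e poly_functions.add by blast
  have "k * l = family_scalar (\<lambda>p q r. c p q r * e p q r)"
    unfolding c e by transfer (simp add: scal.\<iota>_mult T_ideal_0)
  then show "k * l \<in> family_scalar ` poly_functions" using c e poly_functions.mult by blast
next
  have "(0 :: 'k T_family) = family_scalar (\<lambda>p q r. 0)" "(1 :: 'k T_family) = family_scalar (\<lambda>p q r. 1)"
    "(- 1 :: 'k T_family) = family_scalar (\<lambda>p q r. - 1)"
    by (transfer; simp add: scal.\<iota>_minus T_ideal_0)+
  then show "(0 :: 'k T_family) \<in> family_scalar ` poly_functions"
    "(1 :: 'k T_family) \<in> family_scalar ` poly_functions"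
    "(- 1 :: 'k T_family) \<in> family_scalar ` poly_functions"
    using poly_functions.const by blast+
next
  note rel = T_relators_in_T_ideal[unfolded T_relators_def Let_def insert_subset power2_eq_square]
  have diff: "u - (v - w - z) = u + w + z - v" for u v w z :: "generator word \<Rightarrow>\<^sub>0 'k"
    by simp
  show "family_const (gen GenA) * family_const (gen GenA) = family_scalar (\<lambda>p q r. p :: 'k)"
    "family_const (gen GenB) * family_const (gen GenB) = family_scalar (\<lambda>p q r. p :: 'k)"
    "family_const (gen GenC) * family_const (gen GenC) = family_scalar (\<lambda>p q r. p :: 'k)"
    "family_const (gen GenD) * family_const (gen GenD) = family_scalar (\<lambda>p q r. p :: 'k)"
    by (simp_all add: T_family_simps T_family.abs_eq_iff rel)
  show "family_const (gen GenC) * family_const (gen GenA) = family_scalar (\<lambda>p q r. q :: 'k) -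
      family_const (gen GenB) * family_const (gen GenC) - family_const (gen GenA) * family_const (gen GenB)"
    "family_const (gen GenD) * family_const (gen GenA) = family_scalar (\<lambda>p q r. q :: 'k) -
      family_const (gen GenC) * family_const (gen GenD) - family_const (gen GenA) * family_const (gen GenC)"
    "family_const (gen GenD) * family_const (gen GenB) = family_scalar (\<lambda>p q r. q :: 'k) -
      family_const (gen GenB) * family_const (gen GenA) - family_const (gen GenA) * family_const (gen GenD)"
    "family_const (gen GenD) * family_const (gen GenC) = family_scalar (\<lambda>p q r. q :: 'k) -
      family_const (gen GenC) * family_const (gen GenB) - family_const (gen GenB) * family_const (gen GenD)"
    by (simp_all add: T_family_simps T_family.abs_eq_iff diff rel)
  show "(family_const (gen GenC * gen GenB + gen GenB * gen GenA + gen GenA * gen GenC)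
     - family_scalar (\<lambda>p q r. q :: 'k)) ^ 3 = family_scalar (\<lambda>p q r. r)"
    unfolding power3_eq_cube by (simp add: T_family_simps T_family.abs_eq_iff rel[unfolded power3_eq_cube])
qed (auto intro: poly_functions.intros simp: family_const_add family_const_mult)

text \<open>A word arises from \<open>1\<close> by right multiplication with generators, under which
  the span of \<open>Z\<close> is stable.\<close>

lemma family_const_in_span:
  fixes f :: "generator word \<Rightarrow>\<^sub>0 'k::field"
  shows "family_const f \<in> family.K_span family.Z"
proof (induction f rule: poly_mapping_monomial_induct)
  case (single w c)
  have "family_const (prod_list (map gen is) :: generator word \<Rightarrow>\<^sub>0 'k) \<in> family.K_span family.Z"
    for "is" :: "generator list"
  proof (induction "is" rule: rev_induct)
    case Nil
    show ?case using family.one_in_Z_span by (simp add: family_const_1)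
  next
    case (snoc i "is")
    have "family_const (gen i) \<in> {family_const (gen GenA), family_const (gen GenB),
        family_const (gen GenC), family_const (gen GenD)}"
      by (cases i) simp_all
    then show ?case using family.Z_mult[OF snoc.IH] by (simp add: family_const_mult)
  qed
  moreover have "Poly_Mapping.single w c = scal c * prod_list (map gen (letters w))"
  proof -
    have "prod_list (map gen is) = (Poly_Mapping.single (Word is) 1 :: generator word \<Rightarrow>\<^sub>0 'k)" for "is"
      by (induction "is") (simp_all add: gen_def mult_single plus_word_def flip: zero_word_def)
    then show ?thesis by (simp add: scal_def mult_single)
  qed
  moreover have "family_const (scal c) \<in> family_scalar ` poly_functions"
    unfolding family_const_scal using poly_functions.const by blast
  ultimately show ?case by (simp add: family_const_mult family.K_span_smult)
qed (simp add: family_const_add family.K_span_add)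

abbreviation T_x :: "'k::field \<Rightarrow> (generator word \<Rightarrow>\<^sub>0 'k)" where
  "T_x q \<equiv> gen GenC * gen GenB + gen GenB * gen GenA + gen GenA * gen GenC - scal q"

lemma core_word_hom:
  assumes "h 1 = 1" "\<And>u v. h (u * v) = h u * h v" "i < 6"
  shows "core_word (h a) (h b) i = h (core_word a b i)"
proof -
  have "i \<in> {0, 1, 2, 3, 4, 5}" using assms(3) by auto
  then show ?thesis using assms(1,2) by (auto simp: core_word_def)
qed

lemma spanning_word_hom:
  assumes "h 1 = 1" "\<And>u v. h (u * v) = h u * h v" "i \<in> word_indices"
  shows "spanning_word (h a) (h b) (h c) (h x) i = h (spanning_word a b c x i)"
proof -
  have "h u ^ n = h (u ^ n)" for u n by (induction n) (simp_all add: assms)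
  then show ?thesis
    using assms(3) core_word_hom[of h, OF assms(1,2)] by (auto simp: word_indices_def assms(2))
qed

text \<open>The expansion in the universal family is read off at each parameter triple. The same
  coefficient functions \<open>\<kappa>\<close> serve all triples, which is what makes the
  deformation possible.\<close>

lemma T_reduction:
  fixes f :: "generator word \<Rightarrow>\<^sub>0 'k::field"
  obtains \<kappa> where "\<And>i. \<kappa> i \<in> poly_functions"
    "\<And>p q r. f - (\<Sum>(i, e)\<in>word_indices \<times> {..<2}. scal (\<kappa> (i, e) p q r) *
      (spanning_word (gen GenA) (gen GenB) (gen GenC) (T_x q) i * gen GenD ^ e)) \<in> T_ideal p q r"
proof -
  let ?J = "word_indices \<times> {..<2::nat}"
  have "finite ?J" by (simp add: word_indices_def)
  obtain \<kappa>' where \<kappa>': "\<And>i. \<kappa>' i \<in> family_scalar ` (poly_functions :: ('k \<Rightarrow> 'k \<Rightarrow> 'k \<Rightarrow> 'k) set)" and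
    f: "family_const f = (\<Sum>j\<in>?J. \<kappa>' j * (\<lambda>(i, e). spanning_word (family_const (gen GenA))
       (family_const (gen GenB)) (family_const (gen GenC)) (family_const
       (gen GenC * gen GenB + gen GenB * gen GenA + gen GenA * gen GenC) - family_scalar (\<lambda>p q r. q)) i *
       family_const (gen GenD) ^ e) j)"
    by (rule family.K_span_image_sum[OF family_const_in_span[of f, unfolded family.Z_def] \<open>finite ?J\<close>])
      (rule that)
  from \<kappa>' have "\<forall>i. \<exists>c. c \<in> poly_functions \<and> \<kappa>' i = family_scalar c" by blast
  from choice[OF this] obtain \<kappa> where
    \<kappa>: "\<And>i. \<kappa> i \<in> poly_functions" "\<And>i. \<kappa>' i = family_scalar (\<kappa> i)" by blast
  have sum: "(\<Sum>j\<in>J. abs_T_family (g j)) = abs_T_family (\<lambda>p q r. \<Sum>j\<in>J. g j p q r)"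
    if "finite J" for J :: "((nat \<times> nat \<times> nat) \<times> nat) set" and g :: "_ \<Rightarrow> 'k \<Rightarrow> 'k \<Rightarrow> 'k \<Rightarrow> _"
    using that by induction (simp_all add: T_family_simps)
  have power: "abs_T_family g ^ n = abs_T_family (\<lambda>p q r. g p q r ^ n)" for g and n :: nat
    by (induction n) (simp_all add: T_family_simps)
  have core: "core_word (abs_T_family g) (abs_T_family h) i =
      abs_T_family (\<lambda>p q r. core_word (g p q r) (h p q r) i)" if "i < 6" for g h and i :: nat
  proof -
    have "i \<in> {0, 1, 2, 3, 4, 5}" using that by auto
    then show ?thesis by (auto simp: core_word_def T_family_simps)
  qed
  have "(\<kappa>' j * (\<lambda>(i, e). spanning_word (family_const (gen GenA))
       (family_const (gen GenB)) (family_const (gen GenC)) (family_const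
       (gen GenC * gen GenB + gen GenB * gen GenA + gen GenA * gen GenC) - family_scalar (\<lambda>p q r. q)) i *
       family_const (gen GenD) ^ e) j) = abs_T_family (\<lambda>p q r. (\<lambda>(i, e). scal (\<kappa> (i, e) p q r) *
      (spanning_word (gen GenA) (gen GenB) (gen GenC) (T_x q) i * gen GenD ^ e)) j)" if "j \<in> ?J" for j
    using that by (auto simp: \<kappa>(2) T_family_simps power core word_indices_def)
  then have "family_const f = abs_T_family (\<lambda>p q r. \<Sum>j\<in>?J. (\<lambda>(i, e). scal (\<kappa> (i, e) p q r) *
      (spanning_word (gen GenA) (gen GenB) (gen GenC) (T_x q) i * gen GenD ^ e)) j)"
    unfolding f sum[OF \<open>finite ?J\<close>, symmetric] by (intro sum.cong refl)
  then have "f - (\<Sum>(i, e)\<in>?J. scal (\<kappa> (i, e) p q r) *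
      (spanning_word (gen GenA) (gen GenB) (gen GenC) (T_x q) i * gen GenD ^ e)) \<in> T_ideal p q r" for p q r
    unfolding family_const_def T_family.abs_eq_iff by blast
  with \<kappa>(1) that show ?thesis by blast
qed

section \<open>Two representations of dimension six\<close>

fun row6 :: "'a \<Rightarrow> 'a \<Rightarrow> 'a \<Rightarrow> 'a \<Rightarrow> 'a \<Rightarrow> 'a \<Rightarrow> row_index \<Rightarrow> 'a" where
  "row6 x0 x1 x2 y0 y1 y2 V0 = x0"
| "row6 x0 x1 x2 y0 y1 y2 V1 = x1"
| "row6 x0 x1 x2 y0 y1 y2 V2 = x2"
| "row6 x0 x1 x2 y0 y1 y2 W0 = y0"
| "row6 x0 x1 x2 y0 y1 y2 W1 = y1"
| "row6 x0 x1 x2 y0 y1 y2 W2 = y2"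

lemma mat6_eq_iff: "A = B \<longleftrightarrow> (\<forall>i j. entry A i j = entry B i j)"
  using mat6_eqI by metis

text \<open>Matrices act on row vectors from the right. The basis vector \<open>V0\<close> satisfies
  \<open>V0 a = V0 b = s V0\<close>, and the basis consists of \<open>V0 x\<^sup>j\<close> and
  \<open>V0 c x\<^sup>j\<close>; the rows below follow by moving letters across
  \<open>x\<close>.\<close>

definition matrix_X :: "'k::field \<Rightarrow> 'k mat6" where
  "matrix_X r = Mat6 (row6
    (row6 0 1 0 0 0 0)
    (row6 0 0 1 0 0 0)
    (row6 r 0 0 0 0 0)
    (row6 0 0 0 0 1 0)
    (row6 0 0 0 0 0 1)
    (row6 0 0 0 r 0 0))"

definition matrix_A :: "'k::field \<Rightarrow> 'k \<Rightarrow> 'k \<Rightarrow> 'k \<Rightarrow> 'k mat6" where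
  "matrix_A s p q r = Mat6 (row6
    (row6 s 0 0 0 0 0)
    (row6 0 0 0 0 1 0)
    (row6 0 0 s 0 0 0)
    (row6 (q - p) 0 0 (- s) 0 0)
    (row6 0 p 0 0 0 0)
    (row6 r 0 (q - p) 0 0 (- s)))"

definition matrix_B :: "'k::field \<Rightarrow> 'k \<Rightarrow> 'k \<Rightarrow> 'k mat6" where
  "matrix_B s p q = Mat6 (row6
    (row6 s 0 0 0 0 0)
    (row6 0 s 0 0 0 0)
    (row6 0 0 0 0 0 1)
    (row6 (q - p) 1 0 (- s) 0 0)
    (row6 0 (q - p) 0 0 (- s) 0)
    (row6 0 0 p 0 0 0))"

definition matrix_C :: "'k::field \<Rightarrow> 'k \<Rightarrow> 'k \<Rightarrow> 'k mat6" where
  "matrix_C s p q = Mat6 (row6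
    (row6 0 0 0 1 0 0)
    (row6 0 s 0 0 0 0)
    (row6 0 0 s 0 0 0)
    (row6 p 0 0 0 0 0)
    (row6 0 (q - p) 1 0 (- s) 0)
    (row6 0 0 (q - p) 0 0 (- s)))"

text \<open>Multiplication by \<open>x\<close> turns the row space into a free module of rank two over
  \<open>K[x]/(x\<^sup>3 - r)\<close>; as \<open>d\<close> commutes with \<open>x\<close>, it is a \<open>2 \<times> 2\<close> matrix over this ring, with entries
  \<open>L = l x - s b x\<^sup>2\<close>, \<open>1 + n b x + b x\<^sup>2\<close>, \<open>(p - r b) - p n b x + (2 p - q) b x\<^sup>2\<close>, \<open>- L\<close>,
  where \<open>n = 3 p - q\<close>.\<close>

definition matrix_D :: "'k::field \<Rightarrow> 'k \<Rightarrow> 'k \<Rightarrow> 'k \<Rightarrow> 'k \<Rightarrow> 'k \<Rightarrow> 'k mat6" where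
  "matrix_D s p q r l b = (let n = 3 * p - q; g = 2 * p - q in Mat6 (row6
    (row6 0 l (- s * b) 1 (n * b) b)
    (row6 (- r * s * b) 0 l (r * b) 1 (n * b))
    (row6 (r * l) (- r * s * b) 0 (r * n * b) (r * b) 1)
    (row6 (p - r * b) (- p * n * b) (g * b) 0 (- l) (s * b))
    (row6 (r * g * b) (p - r * b) (- p * n * b) (r * s * b) 0 (- l))
    (row6 (- r * p * n * b) (r * g * b) (p - r * b) (- r * l) (r * s * b) 0)))"

lemmas matrix_simps = mat6_eq_iff all_row_index entry_simps sum_row_index
  matrix_A_def matrix_B_def matrix_C_def matrix_X_def matrix_D_def

section \<open>Columns, matrix units and the dimension of the matrix space\<close>

definition column6 :: "(row_index \<Rightarrow> 'k::field) \<Rightarrow> 'k mat6" where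
  "column6 v = Mat6 (\<lambda>i j. if j = V0 then v i else 0)"

definition unit6 :: "row_index \<Rightarrow> row_index \<Rightarrow> 'k::field mat6" where
  "unit6 i j = Mat6 (\<lambda>i' j'. if i' = i \<and> j' = j then 1 else 0)"

lemma mult_column6: "M * column6 v = column6 (\<lambda>i. \<Sum>l\<in>UNIV. entry M i l * v l)"
  by (rule mat6_eqI) (simp add: column6_def entry_simps)

lemma column6_ops: "column6 v + column6 w = column6 (\<lambda>i. v i + w i)"
  "column6 v - column6 w = column6 (\<lambda>i. v i - w i)"
  by (rule mat6_eqI, simp add: column6_def entry_simps)+

lemma unit6_mult: "unit6 i j * M = Mat6 (\<lambda>i' j'. if i' = i then entry M j j' else 0)"
  by (rule mat6_eqI) (simp add: unit6_def entry_simps if_distrib[of "\<lambda>u. u * _"] cong: if_cong)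

lemma mult_unit6: "M * unit6 i j = Mat6 (\<lambda>i' j'. if j' = j then entry M i' i else 0)"
  by (rule mat6_eqI)
    (simp add: unit6_def entry_simps if_distrib[of "\<lambda>u. _ * u"] eq_commute[of _ i] cong: if_cong)

lemma mat6_sum_unit6: "M = (\<Sum>i\<in>UNIV. \<Sum>j\<in>UNIV. scalar6 (entry M i j) * unit6 i j)"
  by (simp add: mat6_eq_iff all_row_index entry_simps(1-5) entry_scalar6_mult sum_row_index unit6_def)

text \<open>The matrix units are a basis, which opens the dimension theory of vector spaces to
  \<open>mat6\<close>.\<close>

interpretation mat6: finite_dimensional_vector_space "\<lambda>(c :: 'k::field) (M :: 'k mat6). scalar6 c * M"
  "range (\<lambda>(i, j). unit6 i j)"
proof -
  interpret vector_space "\<lambda>(c :: 'k::field) (M :: 'k mat6). scalar6 c * M"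
    by standard (simp_all add: algebra_simps scalar6.\<iota>_add scalar6.\<iota>_mult)
  let ?u = "\<lambda>(i, j). unit6 i j :: 'k mat6"
  have unit6_eq: "unit6 i j = (unit6 i' j' :: 'k mat6) \<longleftrightarrow> i = i' \<and> j = j'" for i j i' j'
    by (auto simp: mat6_eq_iff unit6_def)
  then have inj: "inj ?u" by (auto simp: inj_def)
  show "finite_dimensional_vector_space (\<lambda>(c :: 'k::field) (M :: 'k mat6). scalar6 c * M) (range ?u)"
  proof
    show "finite (range ?u)" by simp
    show "independent (range ?u)"
    proof (rule independent_if_scalars_zero)
      fix g M assume sum: "(\<Sum>M\<in>range ?u. scalar6 (g M) * M) = 0" and "M \<in> range ?u"
      then obtain i j where M: "M = unit6 i j" by auto
      have "(\<Sum>i\<in>UNIV. \<Sum>j\<in>UNIV. scalar6 (g (unit6 i j)) * unit6 i j) = 0"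
        using sum unfolding sum.reindex[OF inj] sum.cartesian_product by (simp add: case_prod_beta')
      moreover have "(\<Sum>i\<in>UNIV. \<Sum>j\<in>UNIV. scalar6 (g (unit6 i j)) * unit6 i j) =
          (Mat6 (\<lambda>i j. g (unit6 i j)))"
        by (subst (2) mat6_sum_unit6) simp
      ultimately have "entry (Mat6 (\<lambda>i j. g (unit6 i j))) i j = entry 0 i j" by simp
      with M show "g M = 0" by (simp add: entry_simps)
    qed simp
    have "M \<in> span (range ?u)" for M
      by (subst mat6_sum_unit6) (intro span_sum span_scale span_base, auto)
    then show "span (range ?u) = UNIV" by blast
  qed
qed

lemma mat6_dim_UNIV: "mat6.dim (UNIV :: 'k::field mat6 set) = 36"
proof -
  have "inj (\<lambda>(i, j). unit6 i j :: 'k mat6)"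
    by (auto simp: inj_def mat6_eq_iff unit6_def)
  then have "card (range (\<lambda>(i, j). unit6 i j :: 'k mat6)) = card (UNIV :: (row_index \<times> row_index) set)"
    by (rule card_image)
  also have "\<dots> = 36" by (simp add: UNIV_row_index card_cartesian_product flip: UNIV_Times_UNIV)
  finally show ?thesis by (simp add: mat6.dim_UNIV)
qed

lemma mat6_family_independent:
  fixes w :: "'j \<Rightarrow> 'k::field mat6"
  assumes "finite J" "card J = 36" and span: "mat6.span (w ` J) = UNIV"
    and sum: "(\<Sum>j\<in>J. scalar6 (c j) * w j) = 0" and "j \<in> J"
  shows "c j = 0"
proof -
  \<comment> \<open>The dimension bounds the number of distinct words from below, so none of the 36
    indices share a word.\<close>
  have "36 \<le> card (w ` J)"
    using mat6.dim_le_card[of UNIV "w ` J"] span assms(1) unfolding mat6_dim_UNIV by simp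
  with assms have card: "card (w ` J) = card J" using card_image_le[of J w] by simp
  with assms(1) have inj: "inj_on w J" by (rule eq_card_imp_inj_on)
  have "mat6.independent (w ` J)"
    using mat6.card_le_dim_spanning[of "w ` J" UNIV] assms card unfolding mat6_dim_UNIV by simp
  moreover have "(\<Sum>M\<in>w ` J. scalar6 (c (inv_into J w M)) * M) = 0"
    using sum inj by (simp add: sum.reindex)
  ultimately have "c (inv_into J w (w j)) = 0"
    using mat6.independentD[of "w ` J" "w ` J" "\<lambda>M. c (inv_into J w M)" "w j"] assms by simp
  then show ?thesis using inj assms by simp
qed

text \<open>The choice of \<open>s\<close> fixes the matrices of \<open>a, b, c\<close>, and \<open>\<plusminus> e\<close> distinguishes the two possible
  matrices of \<open>d\<close>.\<close>

locale T_representation =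
  fixes p q r s e k n Del :: "'k::field"
  assumes s: "s * s = p" and k: "k = q - p" and n: "n = 3 * p - q"
    and Del: "Del = n ^ 3 * (p + q) + 4 * p * r"
    and e: "e * e = r + n * n * (p + q)"
    and e_nonzero: "e \<noteq> 0" and r_nonzero: "r \<noteq> 0" and Del_nonzero: "Del \<noteq> 0" and s_nonzero: "s \<noteq> 0"
    and two_nonzero: "(2 :: 'k) \<noteq> 0"
begin

abbreviation "A \<equiv> matrix_A s p q r"
abbreviation "B \<equiv> matrix_B s p q"
abbreviation "C \<equiv> matrix_C s p q"
abbreviation "X \<equiv> matrix_X r"
abbreviation "D \<equiv> matrix_D s p q r"

lemma ss: "s * (s * u) = p * u"
  by (simp add: s mult.assoc[symmetric])

lemma four_nonzero: "(4 :: 'k) \<noteq> 0"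
proof -
  have "(4 :: 'k) = 2 * 2" by simp
  then show ?thesis using two_nonzero by (metis mult_eq_0_iff)
qed

lemma AA: "A * A = scalar6 p" and BB: "B * B = scalar6 p" and CC: "C * C = scalar6 p"
  and CA: "C * A = scalar6 q - B * C - A * B"
  and X_eq: "X = C * B + B * A + A * C - scalar6 q"
  by (simp_all add: matrix_simps algebra_simps s ss)

lemma XXX: "X ^ 3 = scalar6 r"
  by (simp add: power3_eq_cube matrix_simps)

text \<open>One linear equation between \<open>l\<close> and \<open>b\<close> suffices for all three
  relations.\<close>

lemma
  assumes "2 * s * l = - (1 + k * n * b)"
  shows DA: "D l b * A = scalar6 q - C * D l b - A * C"
    and DB: "D l b * B = scalar6 q - B * A - A * D l b"
    and DC: "D l b * C = scalar6 q - C * B - B * D l b"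
  \<comment> \<open>The multiple by \<open>r\<close> serves the entries in which a power of
    \<open>x\<close> has wrapped around.\<close>
  using assms arg_cong[OF assms, of "\<lambda>u. r * u"]
  by (simp_all add: matrix_simps Let_def k n algebra_simps s ss)

text \<open>As a trace-free \<open>2 \<times> 2\<close> matrix over
  \<open>K[x]/(x\<^sup>3 - r)\<close>, the matrix squares to \<open>L\<^sup>2\<close> plus the
  product of the off-diagonal entries. Its constant coefficient is \<open>p\<close> by
  \<open>lin\<close>, the coefficient of \<open>x\<close> cancels, and \<open>quad\<close> kills
  that of \<open>x\<^sup>2\<close>.\<close>

lemma DD:
  assumes lin: "2 * s * l = - (1 + k * n * b)" and quad: "l * l = p * n * n * b * b - n * b + r * b * b"
  shows "D l b * D l b = scalar6 p"
  using assms arg_cong[OF lin, of "\<lambda>u. b * r * u"] arg_cong[OF quad, of "\<lambda>u. r * u"]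
  by (simp add: matrix_simps Let_def k n algebra_simps s ss)

text \<open>The slopes are the roots \<open>b\<close> of \<open>Del b\<^sup>2 - 2 n (p + q) b - 1\<close>, to which the equation for \<open>l\<^sup>2\<close>
  in \<open>DD\<close> reduces after elimination of \<open>l\<close>.\<close>

definition "slope \<epsilon> = (n * (p + q) + 2 * \<epsilon> * s * e) / Del"
definition "offset \<epsilon> = - (1 + k * n * slope \<epsilon>) / (2 * s)"

lemma offset: "2 * s * offset \<epsilon> = - (1 + k * n * slope \<epsilon>)"
  using s_nonzero two_nonzero by (simp add: offset_def)

text \<open>Completing the square: \<open>Del + n\<^sup>2 (p + q)\<^sup>2 = 4 p e\<^sup>2\<close>
  because \<open>n + p + q = 4 p\<close>. This is the origin of the equation for
  \<open>e\<close>.\<close>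

lemma slope_quadratic:
  assumes "\<epsilon> * \<epsilon> = 1"
  shows "Del * slope \<epsilon> * slope \<epsilon> - 2 * n * (p + q) * slope \<epsilon> - 1 = 0"
proof -
  have 1: "Del * slope \<epsilon> - n * (p + q) = 2 * \<epsilon> * s * e"
    using Del_nonzero by (simp add: slope_def)
  have "Del * (Del * slope \<epsilon> * slope \<epsilon> - 2 * n * (p + q) * slope \<epsilon> - 1) =
      (Del * slope \<epsilon> - n * (p + q)) ^ 2 - (n * n * (p + q) * (p + q) + Del)"
    by (simp add: power2_eq_square algebra_simps)
  also have "(Del * slope \<epsilon> - n * (p + q)) ^ 2 = 4 * (\<epsilon> * \<epsilon>) * (s * s) * (e * e)"
    unfolding 1 by (simp add: power2_eq_square algebra_simps)
  also have "\<dots> - (n * n * (p + q) * (p + q) + Del) = 0"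
    unfolding assms s e Del n by (simp add: algebra_simps power3_eq_cube)
  finally show ?thesis using Del_nonzero by simp
qed

lemma offset_quadratic:
  assumes "\<epsilon> * \<epsilon> = 1"
  shows "offset \<epsilon> * offset \<epsilon> =
    p * n * n * slope \<epsilon> * slope \<epsilon> - n * slope \<epsilon> + r * slope \<epsilon> * slope \<epsilon>"
proof -
  let ?b = "slope \<epsilon>"
  have "(2 * s * offset \<epsilon>) * (2 * s * offset \<epsilon>) = (1 + k * n * ?b) * (1 + k * n * ?b)"
    unfolding offset by (simp add: algebra_simps)
  also have "\<dots> = 4 * p * (p * n * n * ?b * ?b - n * ?b + r * ?b * ?b)
      - (Del * ?b * ?b - 2 * n * (p + q) * ?b - 1)"
    unfolding Del k n by (simp add: algebra_simps power3_eq_cube)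
  also have "\<dots> = 4 * p * (p * n * n * ?b * ?b - n * ?b + r * ?b * ?b)"
    unfolding slope_quadratic[OF assms] by simp
  also have "(2 * s * offset \<epsilon>) * (2 * s * offset \<epsilon>) = 4 * p * (offset \<epsilon> * offset \<epsilon>)"
    unfolding s[symmetric] by (simp add: algebra_simps)
  finally have "4 * p * (offset \<epsilon> * offset \<epsilon>) = 4 * p * (p * n * n * ?b * ?b - n * ?b + r * ?b * ?b)" .
  moreover have "4 * p \<noteq> 0"
    using s_nonzero four_nonzero s by auto
  ultimately show ?thesis by simp
qed

definition "D' \<epsilon> = D (offset \<epsilon>) (slope \<epsilon>)"

lemma D'_relations:
  assumes "\<epsilon> * \<epsilon> = 1"
  shows "D' \<epsilon> * D' \<epsilon> = scalar6 p"
    and "D' \<epsilon> * A = scalar6 q - C * D' \<epsilon> - A * C"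
    and "D' \<epsilon> * B = scalar6 q - B * A - A * D' \<epsilon>"
    and "D' \<epsilon> * C = scalar6 q - C * B - B * D' \<epsilon>"
  unfolding D'_def by (intro DD DA DB DC offset offset_quadratic assms)+

lemma slope_diff: "slope 1 - slope (-1) \<noteq> 0"
proof -
  have "slope 1 - slope (-1) = 2 * (2 * s * e) / Del"
    unfolding slope_def diff_divide_distrib[symmetric] by (simp add: algebra_simps)
  then show ?thesis using Del_nonzero four_nonzero s_nonzero e_nonzero by auto
qed

text \<open>The difference of the two matrices of \<open>d\<close> is trace-free over
  \<open>K[x]/(x\<^sup>3 - r)\<close>, with determinant a constant times \<open>x\<^sup>2\<close>.
  Since \<open>r\<close> is nonzero, \<open>x\<close> is invertible and so is the
  difference.\<close>

lemma D'_diff_square: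
  obtains c where "c \<noteq> 0" "(D' 1 - D' (-1)) * (D' 1 - D' (-1)) = scalar6 c * (X * X)"
proof -
  define \<delta> where "\<delta> = slope 1 - slope (-1)"
  define \<gamma> where "\<gamma> = offset 1 - offset (-1)"
  have lin: "2 * s * \<gamma> = - k * n * \<delta>"
    using offset[of 1] offset[of "-1"] by (simp add: \<gamma>_def \<delta>_def algebra_simps)
  have slope: "slope 1 = slope (-1) + \<delta>" and off: "offset 1 = offset (-1) + \<gamma>"
    by (simp_all add: \<delta>_def \<gamma>_def)
  let ?c = "\<gamma> * \<gamma> - (p * n * n + r) * \<delta> * \<delta>"
  have "(D' 1 - D' (-1)) * (D' 1 - D' (-1)) = scalar6 ?c * (X * X)"
    unfolding D'_def slope off
    using arg_cong[OF lin, of "\<lambda>u. \<delta> * r * u"] arg_cong[OF lin, of "\<lambda>u. \<delta> * r * r * u"]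
    by (simp add: matrix_simps Let_def k n algebra_simps s ss)
  moreover have "?c \<noteq> 0"
  proof
    assume "?c = 0"
    \<comment> \<open>The factor \<open>4 * p\<close> brings in \<open>2 * s * \<gamma>\<close>,
      which \<open>lin\<close> expresses by \<open>\<delta>\<close>.\<close>
    then have "0 = 4 * p * ?c" by simp
    also have "\<dots> = (2 * s * \<gamma>) * (2 * s * \<gamma>) - 4 * p * (p * n * n + r) * \<delta> * \<delta>"
      unfolding s[symmetric] by (simp add: algebra_simps)
    also have "\<dots> = - (\<delta> * \<delta> * Del)"
      unfolding lin Del k n by (simp add: algebra_simps power3_eq_cube)
    finally show False using slope_diff Del_nonzero by (simp add: \<delta>_def)
  qed
  ultimately show ?thesis using that by blast
qed

section \<open>The words without \<open>d\<close> span all matrices\<close>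

sublocale T: T_relations "range scalar6" "scalar6 p" "scalar6 q" "scalar6 r" A B C "D' 1" X
proof
  have scalar6_image: "\<And>c. c = scalar6 u \<Longrightarrow> c \<in> range scalar6" for u :: 'k by blast
  show "k + l \<in> range scalar6" "k * l \<in> range scalar6"
    if "k \<in> range scalar6" "l \<in> range scalar6" for k l :: "'k mat6"
    using that by (auto simp flip: scalar6.\<iota>_add scalar6.\<iota>_mult)
  show "- 1 \<in> range (scalar6 :: 'k \<Rightarrow> _)"
    by (rule scalar6_image[of _ "- 1"]) (simp add: scalar6.\<iota>_minus)
  show "(0 :: 'k mat6) \<in> range scalar6" "(1 :: 'k mat6) \<in> range scalar6"
    using scalar6_image[of 0 0] scalar6_image[of 1 1] by simp_all
qed (simp_all add: AA BB CC CA X_eq[symmetric] XXX D'_relations, auto simp: scalar6.\<iota>_central)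

text \<open>Since \<open>1\<close> lies in the span of \<open>T.W\<close>, every right multiplier of
  the span lies in it. The multipliers form an algebra containing \<open>A\<close>,
  \<open>B\<close>, \<open>C\<close>, so it remains to produce the matrix units from these.\<close>

definition "multipliers = {g. \<forall>y\<in>T.K_span T.W. y * g \<in> T.K_span T.W}"

lemma multipliers_add: "g \<in> multipliers \<Longrightarrow> h \<in> multipliers \<Longrightarrow> g + h \<in> multipliers"
  and multipliers_diff: "g \<in> multipliers \<Longrightarrow> h \<in> multipliers \<Longrightarrow> g - h \<in> multipliers"
  and multipliers_mult: "g \<in> multipliers \<Longrightarrow> h \<in> multipliers \<Longrightarrow> g * h \<in> multipliers"
  unfolding multipliers_def
  by (auto simp: distrib_left right_diff_distrib T.K_span_add T.K_span_diff simp flip: mult.assoc)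

lemma multipliers_scalar6: "scalar6 c \<in> multipliers"
  unfolding multipliers_def by (auto simp: T.K_span_smult simp flip: scalar6.\<iota>_central)

lemma multipliers_A: "A \<in> multipliers" and multipliers_B: "B \<in> multipliers"
  and multipliers_C: "C \<in> multipliers"
  unfolding multipliers_def using T.W_mult by auto

lemma multipliers_X: "X \<in> multipliers"
  by (subst X_eq) (intro multipliers_add multipliers_diff multipliers_mult
      multipliers_A multipliers_B multipliers_C multipliers_scalar6)

lemmas multipliers_intros = multipliers_add multipliers_diff multipliers_mult
  multipliers_A multipliers_B multipliers_C multipliers_X multipliers_scalar6

text \<open>\<open>\<Theta>\<close> has rank one. Over \<open>K[x]\<close> its nonzero column is a combination of two basis columns, with
  coefficients \<open>F\<close> and \<open>G\<close> after multiplication by \<open>x\<close>. The two identities below eliminate one basis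
  column each, using the action of \<open>a + b + c\<close>, which commutes with \<open>x\<close>.\<close>

definition "\<Theta> = (A + scalar6 s) * (B + scalar6 s) * (A + scalar6 s) - scalar6 (p + q) * (A + scalar6 s)"

text \<open>The relations of \<open>a\<close> and \<open>b\<close> give
  \<open>\<Theta> A = s \<Theta> = \<Theta> B\<close>, so each row of \<open>\<Theta>\<close> is a
  common eigenvector like the basis vector \<open>V0\<close>. This accounts for the single nonzero
  column.\<close>

lemma \<Theta>_column: "\<Theta> = column6 (row6 (2 * s * n) 0 (2 * s * r) (k * n) 0 (2 * p * r))"
  unfolding \<Theta>_def
  by (simp add: matrix_simps column6_def k n) (simp add: algebra_simps s ss)

definition "F = scalar6 (2 * s * r) + scalar6 (2 * s * n) * (X * X)"
definition "G = scalar6 (2 * p * r) + scalar6 (k * n) * (X * X)"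

lemma unit_V1:
  "((scalar6 (p + 2 * k) + X) * F - scalar6 (2 * s) * G - G * (A + B + C)) * \<Theta> =
    scalar6 (r * Del) * unit6 V1 V0"
  unfolding \<Theta>_column F_def G_def
  by (simp only: distrib_left distrib_right left_diff_distrib right_diff_distrib mult.assoc
      mult_column6 column6_ops)
    (simp add: matrix_simps column6_def unit6_def Del k n, simp add: algebra_simps power3_eq_cube s ss)

lemma unit_W1:
  "(F * (A + B + C) - scalar6 (2 * s) * F - G) * \<Theta> = scalar6 (r * Del) * unit6 W1 V0"
  unfolding \<Theta>_column F_def G_def
  by (simp only: distrib_left distrib_right left_diff_distrib right_diff_distrib mult.assoc
      mult_column6 column6_ops)
    (simp add: matrix_simps column6_def unit6_def Del k n, simp add: algebra_simps power3_eq_cube s ss)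

lemma units_multipliers: "unit6 i j \<in> multipliers"
proof -
  have units: "unit6 i j \<in> multipliers" if "scalar6 (r * Del) * unit6 i j \<in> multipliers" for i j
  proof -
    have "scalar6 (1 / (r * Del)) * (scalar6 (r * Del) * unit6 i j) \<in> multipliers"
      by (intro multipliers_mult multipliers_scalar6 that)
    then show ?thesis using r_nonzero Del_nonzero by (simp flip: mult.assoc scalar6.\<iota>_mult)
  qed
  have "unit6 V1 V0 \<in> multipliers" "unit6 W1 V0 \<in> multipliers"
    by (intro units, unfold unit_V1[symmetric] unit_W1[symmetric] F_def G_def \<Theta>_def,
      intro multipliers_intros)+
  \<comment> \<open>Left multiplication by \<open>X\<close> shifts the row index cyclically within
    \<open>V\<close> and within \<open>W\<close>, up to the factor \<open>r\<close>.\<close>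
  moreover have "unit6 V0 V0 = X * unit6 V1 V0" "unit6 W0 V0 = X * unit6 W1 V0"
    "unit6 V2 V0 = scalar6 (1 / r) * (X * unit6 V0 V0)" "unit6 W2 V0 = scalar6 (1 / r) * (X * unit6 W0 V0)"
    using r_nonzero
    by (simp_all add: mult_unit6) (simp_all add: matrix_simps unit6_def)
  ultimately have V0: "unit6 i V0 \<in> multipliers" for i
    by (cases i) (auto intro!: multipliers_mult multipliers_X multipliers_scalar6)
  \<comment> \<open>Right multiplication by \<open>X\<close> and \<open>C\<close> reaches every
    column, as \<open>V0\<close> generates the row space.\<close>
  have "unit6 i V1 = unit6 i V0 * X" "unit6 i V2 = unit6 i V0 * X * X" "unit6 i W0 = unit6 i V0 * C"
    "unit6 i W1 = unit6 i V0 * C * X" "unit6 i W2 = unit6 i V0 * C * X * X"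
    by (simp_all add: unit6_mult mult.assoc) (simp_all add: matrix_simps unit6_def)
  then show ?thesis
    by (cases j) (auto intro!: V0 multipliers_mult multipliers_X multipliers_C)
qed

lemma span_W: "T.K_span T.W = UNIV"
proof -
  have "M \<in> multipliers" for M
    by (subst mat6_sum_unit6, unfold sum_row_index)
      (intro multipliers_add multipliers_mult multipliers_scalar6 units_multipliers)
  moreover have "1 \<in> T.K_span T.W"
    using T.W_mem[of 1 0 0] by (intro T.K_span_base) (simp add: T.U_eq)
  ultimately have "M \<in> T.K_span T.W" for M
    unfolding multipliers_def by (metis (no_types, lifting) mem_Collect_eq mult_1)
  then show ?thesis by blast
qed

section \<open>Linear independence of the 72 words\<close>

lemma words_independent:
  assumes "(\<Sum>i\<in>word_indices. scalar6 (c i) * spanning_word A B C X i) = 0" "i \<in> word_indices"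
  shows "c i = 0"
proof (rule mat6_family_independent[OF _ _ _ assms])
  show "finite word_indices" "card word_indices = 36"
    by (simp_all add: word_indices_def card_cartesian_product)
  \<comment> \<open>Spans with scalar matrices as coefficients are contained in the linear spans of
    \<open>mat6\<close>, where 36 spanning elements are independent by dimension.\<close>
  have "y \<in> mat6.span T.W" if "y \<in> T.K_span T.W" for y
    using that
  proof induction
    case (K_span_step k b y)
    then obtain c where "k = scalar6 c" by blast
    with K_span_step show ?case by (auto intro: mat6.span_add mat6.span_scale mat6.span_base)
  qed (rule mat6.span_zero)
  then have "mat6.span T.W = UNIV" unfolding span_W by blast
  then show "mat6.span (spanning_word A B C X ` word_indices) = UNIV" unfolding T.W_def .
qed

text \<open>Subtracting the relations for the two matrices of \<open>d\<close> leaves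
  \<open>Y 1\<close> times an invertible matrix, so \<open>Y 1 = 0\<close> and then
  \<open>Y 0 = 0\<close>. Both are combinations of the independent words without
  \<open>d\<close>.\<close>

lemma words_independent2:
  assumes sum: "\<And>\<epsilon>. \<epsilon> \<in> {1, - 1} \<Longrightarrow>
      (\<Sum>(i, f)\<in>word_indices \<times> {..<2}. scalar6 (c (i, f)) * (spanning_word A B C X i * D' \<epsilon> ^ f)) = 0"
    and "i \<in> word_indices" "f < 2"
  shows "c (i, f) = 0"
proof -
  define Y where "Y f = (\<Sum>i\<in>word_indices. scalar6 (c (i, f)) * spanning_word A B C X i)" for f :: nat
  have Y: "Y 0 + Y 1 * D' \<epsilon> = 0" if "\<epsilon> \<in> {1, -1}" for \<epsilon>
    using sum[OF that]
    by (simp add: Y_def sum.cartesian_product[symmetric] sum_distrib_right mult.assoc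
        sum.distrib lessThan_nat_numeral numeral_2_eq_2)
  from Y[of 1] Y[of "-1"] have "Y 1 * (D' 1 - D' (-1)) = 0"
    by (simp add: right_diff_distrib) (metis add_left_cancel)
  moreover obtain u where u: "u \<noteq> 0" "(D' 1 - D' (-1)) * (D' 1 - D' (-1)) = scalar6 u * (X * X)"
    by (rule D'_diff_square)
  ultimately have "Y 1 * (scalar6 u * (X * X)) = 0" by (metis mult.assoc mult_zero_left)
  also have "Y 1 * (scalar6 u * (X * X)) = scalar6 u * (Y 1 * (X * X))"
    by (metis mult.assoc scalar6.\<iota>_central)
  \<comment> \<open>A further factor \<open>X\<close> completes \<open>X ^ 3\<close>, the scalar
    \<open>r\<close>, so no inverse matrix has to be named.\<close>
  finally have "scalar6 (1 / (u * r)) * (scalar6 u * (Y 1 * (X * X))) * X = 0"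
    by (simp only: mult_zero_left mult_zero_right)
  then have "scalar6 (1 / (u * r)) * (scalar6 u * (Y 1 * X ^ 3)) = 0"
    by (simp only: power3_eq_cube mult.assoc)
  also have "Y 1 * X ^ 3 = scalar6 r * Y 1" by (simp add: XXX scalar6.\<iota>_central)
  also have "scalar6 (1 / (u * r)) * (scalar6 u * (scalar6 r * Y 1)) = scalar6 (1 / (u * r) * u * r) * Y 1"
    by (simp only: scalar6.\<iota>_mult mult.assoc)
  also have "\<dots> = Y 1" using u r_nonzero by simp
  finally have "Y 1 = 0" .
  moreover have "Y 0 = 0" using Y[of 1] \<open>Y 1 = 0\<close> by simp
  moreover have "f = 0 \<or> f = 1" using \<open>f < 2\<close> by auto
  ultimately have "Y f = 0" by auto
  then show ?thesis
    unfolding Y_def using words_independent[of "\<lambda>i. c (i, f)"] assms(2) by blast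
qed

end

section \<open>Deformation\<close>

text \<open>Over a finite field, one plus the product of all \<open>x - a\<close> would have
  positive degree and no root.\<close>

lemma infinite_UNIV_alg_closed_field: "infinite (UNIV :: 'k::alg_closed_field set)"
proof
  assume fin: "finite (UNIV :: 'k set)"
  define P where "P = (\<Prod>a\<in>UNIV. [:- a, 1 :: 'k:])"
  have "degree P = card (UNIV :: 'k set)"
    unfolding P_def by (subst degree_prod_eq_sum_degree) simp_all
  then have "degree P > 0" using fin by (simp add: card_gt_0_iff)
  then have "degree (P + 1) > 0" by (subst degree_add_eq_left) simp_all
  then obtain x where "poly (P + 1) x = 0" using alg_closed_imp_poly_has_root by blast
  moreover have "poly P x = 0" using fin by (auto simp: P_def poly_prod)
  ultimately show False by simp
qed

lemma poly_eq_0_off_roots: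
  fixes P Q :: "'k::alg_closed_field poly"
  assumes "Q \<noteq> 0" and P: "\<And>t. poly Q t \<noteq> 0 \<Longrightarrow> poly P t = 0"
  shows "P = 0"
proof (rule ccontr)
  assume "P \<noteq> 0"
  with assms(1) have "finite {t. poly (P * Q) t = 0}" by (intro poly_roots_finite) simp
  moreover have "{t. poly (P * Q) t = 0} = UNIV" using P by auto
  ultimately show False using infinite_UNIV_alg_closed_field by metis
qed

lemma poly_function_on_line:
  assumes "c \<in> poly_functions"
  obtains P where "\<And>t. poly P t = c (p + t) q (r + t)"
proof -
  have "\<exists>P. \<forall>t. poly P t = c (p + t) q (r + t)"
    using assms
  proof induction
    case (const c)
    show ?case by (rule exI[of _ "[:c:]"]) simp
  next
    case fst
    show ?case by (rule exI[of _ "[:p, 1:]"]) simp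
  next
    case snd
    show ?case by (rule exI[of _ "[:q:]"]) simp
  next
    case thd
    show ?case by (rule exI[of _ "[:r, 1:]"]) simp
  next
    case (add f g)
    then show ?case by (metis poly_add)
  next
    case (mult f g)
    then show ?case by (metis poly_mult)
  qed
  with that show ?thesis by blast
qed

lemma of_nat_prime_nonzero:
  assumes "CHAR('k::field) \<noteq> l" "prime l"
  shows "(of_nat l :: 'k) \<noteq> 0"
  using assms by (auto simp: of_nat_eq_0_iff_char_dvd prime_nat_iff)

text \<open>\<open>Q\<close> is the product of the four quantities that must not vanish, restricted
  to the line of the deformation. Since \<open>n\<close> has leading coefficient \<open>3\<close> in
  \<open>t\<close>, the last two have degrees \<open>4\<close> and \<open>3\<close>, so they are
  nonzero polynomials.\<close>

lemma generic_parameters: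
  fixes \<alpha>1 \<alpha>2 \<alpha>3 :: "'k::alg_closed_field"
  assumes "(2 :: 'k) \<noteq> 0" "(3 :: 'k) \<noteq> 0"
  obtains Q where "Q \<noteq> 0"
    "\<And>t p q r n. poly Q t \<noteq> 0 \<Longrightarrow> p = \<alpha>1 + t \<Longrightarrow> q = \<alpha>2 \<Longrightarrow> r = \<alpha>3 + t \<Longrightarrow> n = 3 * p - q \<Longrightarrow>
      p \<noteq> 0 \<and> r \<noteq> 0 \<and> n ^ 3 * (p + q) + 4 * p * r \<noteq> 0 \<and> r + n * n * (p + q) \<noteq> 0"
proof -
  define P N where "P = [:\<alpha>1, 1:]" and "N = [:3 * \<alpha>1 - \<alpha>2, 3:]"
  define R S where "R = [:\<alpha>3, 1:]" and "S = [:\<alpha>1 + \<alpha>2, 1:]"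
  have deg: "degree P = 1" "degree N = 1" "degree R = 1" "degree S = 1"
    using assms(2) by (simp_all add: P_def N_def R_def S_def)
  then have nz: "P \<noteq> 0" "N \<noteq> 0" "R \<noteq> 0" "S \<noteq> 0" by auto
  have "degree (N ^ 3 * S) = 4" "degree (N * N * S) = 3"
    using deg nz by (simp_all add: degree_mult_eq degree_power_eq)
  moreover have "degree (Polynomial.smult 4 (P * R)) \<le> 2"
    using deg nz by (intro order.trans[OF degree_smult_le]) (simp add: degree_mult_eq)
  ultimately have "degree (N ^ 3 * S + Polynomial.smult 4 (P * R)) = 4" "degree (R + N * N * S) = 3"
    using deg by (simp_all add: degree_add_eq_left degree_add_eq_right)
  then have "N ^ 3 * S + Polynomial.smult 4 (P * R) \<noteq> 0" "R + N * N * S \<noteq> 0" by force+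
  with nz have "P * R * (N ^ 3 * S + Polynomial.smult 4 (P * R)) * (R + N * N * S) \<noteq> 0" by simp
  then show ?thesis
  proof (rule that)
    fix t p q r n
    assume Q: "poly (P * R * (N ^ 3 * S + Polynomial.smult 4 (P * R)) * (R + N * N * S)) t \<noteq> 0"
      and *: "p = \<alpha>1 + t" "q = \<alpha>2" "r = \<alpha>3 + t" "n = 3 * p - q"
    have "poly P t = p" "poly R t = r" "poly N t = n" "poly S t = p + q"
      by (simp_all add: * P_def N_def R_def S_def algebra_simps)
    with Q show "p \<noteq> 0 \<and> r \<noteq> 0 \<and> n ^ 3 * (p + q) + 4 * p * r \<noteq> 0 \<and> r + n * n * (p + q) \<noteq> 0"
      by (simp add: mult.assoc)
  qed
qed

theorem corollary4p12:
  fixes \<alpha>1 \<alpha>2 \<alpha>3 :: "'k::alg_closed_field"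
    and m :: nat
    and f :: "nat word \<Rightarrow>\<^sub>0 'k"
  assumes "CHAR('k) \<noteq> 2" and "CHAR('k) \<noteq> 3"
    and "polynomial_identity
           (algebra_prod (module_mat TYPE('k) 6 6) (module_mat TYPE('k) 6 6)) m f"
  shows "polynomial_identity (T_algebra \<alpha>1 \<alpha>2 \<alpha>3) m f"
proof (rule polynomial_identity_T_algebraI)
  show "f \<in> ncpolys m" using assms(3) by (simp add: polynomial_identity_def)
  have two: "(2 :: 'k) \<noteq> 0" and three: "(3 :: 'k) \<noteq> 0"
    using of_nat_prime_nonzero[OF assms(1)] of_nat_prime_nonzero[OF assms(2)] by simp_all
  fix Y :: "nat \<Rightarrow> (generator word \<Rightarrow>\<^sub>0 'k)"
  obtain \<kappa> where \<kappa>: "\<And>i. \<kappa> i \<in> poly_functions"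
    "\<And>p q r. free_eval scal Y f - (\<Sum>(i, e)\<in>word_indices \<times> {..<2}. scal (\<kappa> (i, e) p q r) *
      (spanning_word (gen GenA) (gen GenB) (gen GenC) (T_x q) i * gen GenD ^ e)) \<in> T_ideal p q r"
    by (rule T_reduction[of "free_eval scal Y f"]) (rule that)
  obtain Q where "Q \<noteq> 0" and Q: "\<And>t p q r n. poly Q t \<noteq> 0 \<Longrightarrow>
      p = \<alpha>1 + t \<Longrightarrow> q = \<alpha>2 \<Longrightarrow> r = \<alpha>3 + t \<Longrightarrow> n = 3 * p - q \<Longrightarrow>
      p \<noteq> 0 \<and> r \<noteq> 0 \<and> n ^ 3 * (p + q) + 4 * p * r \<noteq> 0 \<and> r + n * n * (p + q) \<noteq> 0"
    by (rule generic_parameters[OF two three]) (rule that)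
  have generic: "\<kappa> (i, l) (\<alpha>1 + t) \<alpha>2 (\<alpha>3 + t) = 0"
    if "poly Q t \<noteq> 0" and i: "i \<in> word_indices" "l < 2" for t i l
  proof -
    define p q r n where "p = \<alpha>1 + t" and "q = \<alpha>2" and "r = \<alpha>3 + t" and "n = 3 * p - q"
    note good = Q[OF that(1) p_def q_def r_def n_def]
    \<comment> \<open>Algebraic closedness supplies the square roots on which the representations
      depend; both are nonzero by \<open>good\<close>.\<close>
    obtain s where s: "s ^ 2 = p" using nth_root_exists[of 2 p] by auto
    obtain e where e: "e ^ 2 = r + n * n * (p + q)" using nth_root_exists[of 2] by auto
    interpret T_representation p q r s e "q - p" n "n ^ 3 * (p + q) + 4 * p * r"
      using good s e two by unfold_locales (auto simp: n_def power2_eq_square)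
    have "(\<Sum>(i, l)\<in>word_indices \<times> {..<2}. scalar6 (\<kappa> (i, l) p q r) *
        (spanning_word A B C X i * D' \<epsilon> ^ l)) = 0" if "\<epsilon> \<in> {1, - 1}" for \<epsilon>
    proof -
      define \<phi> where "\<phi> g = (case g of GenA \<Rightarrow> A | GenB \<Rightarrow> B | GenC \<Rightarrow> C | GenD \<Rightarrow> D' \<epsilon>)" for g
      let ?ev = "free_eval scalar6 \<phi>"
      note ev = scalar6.free_eval_add scalar6.free_eval_diff scalar6.free_eval_mult
        scalar6.free_eval_power scalar6.free_eval_sum
      have \<phi>: "?ev (gen GenA) = A" "?ev (gen GenB) = B" "?ev (gen GenC) = C" "?ev (gen GenD) = D' \<epsilon>"
        by (simp_all add: \<phi>_def)
      have \<epsilon>: "\<epsilon> * \<epsilon> = 1" using that by auto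
      have T_x: "?ev (T_x q) = X" by (simp only: ev \<phi> scalar6.free_eval_scal X_eq)
      have "?ev g = 0" if "g \<in> T_relators p q r" for g
        using that unfolding T_relators_def Let_def
        by (auto simp only: insert_iff empty_iff ev \<phi> scalar6.free_eval_scal power2_eq_square
            AA BB CC CA D'_relations[OF \<epsilon>] X_eq[symmetric] XXX; simp)
      then have "?ev (free_eval scal Y f - (\<Sum>(i, l)\<in>word_indices \<times> {..<2}. scal (\<kappa> (i, l) p q r) *
          (spanning_word (gen GenA) (gen GenB) (gen GenC) (T_x q) i * gen GenD ^ l))) = 0"
        using T_ideal_eval_eq_0[OF scalar6.central_embedding_axioms _ \<kappa>(2)] by blast
      \<comment> \<open>This is the value of \<open>f\<close> at the matrices
        \<open>?ev (Y i)\<close>, to which the identity applies.\<close>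
      moreover have "?ev (free_eval scal Y f) = 0"
        unfolding scalar6.free_eval_free_eval by (rule polynomial_identity_mat6[OF assms(3)])
      ultimately have "(\<Sum>(i, l)\<in>word_indices \<times> {..<2}. ?ev (scal (\<kappa> (i, l) p q r) *
          (spanning_word (gen GenA) (gen GenB) (gen GenC) (T_x q) i * gen GenD ^ l))) = 0"
        by (simp add: ev case_prod_beta' del: spanning_word.simps)
      moreover have word: "?ev (spanning_word (gen GenA) (gen GenB) (gen GenC) (T_x q) i) =
          spanning_word A B C X i" if "i \<in> word_indices" for i
        using spanning_word_hom[of ?ev, OF _ _ that, of "gen GenA" "gen GenB" "gen GenC" "T_x q"]
        unfolding \<phi> T_x by (simp add: scalar6.free_eval_mult)
      have "(\<Sum>(i, l)\<in>word_indices \<times> {..<2}. ?ev (scal (\<kappa> (i, l) p q r) *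
          (spanning_word (gen GenA) (gen GenB) (gen GenC) (T_x q) i * gen GenD ^ l))) =
          (\<Sum>(i, l)\<in>word_indices \<times> {..<2}. scalar6 (\<kappa> (i, l) p q r) *
          (spanning_word A B C X i * D' \<epsilon> ^ l))"
        by (intro sum.cong refl) (auto simp: ev \<phi>_def word simp del: spanning_word.simps)
      ultimately show ?thesis by simp
    qed
    from words_independent2[OF this i] show ?thesis by (simp add: p_def q_def r_def)
  qed
  have "\<kappa> (i, l) \<alpha>1 \<alpha>2 \<alpha>3 = 0" if "i \<in> word_indices" "l < 2" for i l
  proof -
    obtain P where P: "\<And>t. poly P t = \<kappa> (i, l) (\<alpha>1 + t) \<alpha>2 (\<alpha>3 + t)"
      by (rule poly_function_on_line[OF \<kappa>(1)[of "(i, l)"], of \<alpha>1 \<alpha>2 \<alpha>3]) (rule that)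
    have "P = 0" by (rule poly_eq_0_off_roots[OF \<open>Q \<noteq> 0\<close>]) (simp add: P generic that)
    then show ?thesis using P[of 0] by simp
  qed
  then have "(\<Sum>(i, e)\<in>word_indices \<times> {..<2}. scal (\<kappa> (i, e) \<alpha>1 \<alpha>2 \<alpha>3) *
      (spanning_word (gen GenA) (gen GenB) (gen GenC) (T_x \<alpha>2) i * gen GenD ^ e)) = 0"
    by (intro sum.neutral) (auto simp del: spanning_word.simps)
  with \<kappa>(2)[of \<alpha>1 \<alpha>2 \<alpha>3] show "free_eval scal Y f \<in> T_ideal \<alpha>1 \<alpha>2 \<alpha>3" by simp
qed

end
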